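(* Let $k\{Y\}=k\{y_1,\ldots,y_l\}$ be a ring of differential polynomials over a differential field $k$ of characteristic zero, with a fixed ranking. Let $I$ be a characterizable differential ideal with canonical characteristic set $\mathbb{C}=C_1,\ldots,C_p$ and set of non-leaders $N$. Then every characteristic set of $I$ whose initials contain only non-leaders (i.e. lie in $k[N]$) can be obtained from $\mathbb{C}$ by multiplying its elements by some polynomials from $k[N]$.
   Context: $\Delta=\{\delta_1,\ldots,\delta_n\}$ is a finite set of commuting derivations, $\Theta$ the free commutative monoid of derivative operators $\delta_1^{k_1}\cdots\delta_n^{k_n}$. $k\{Y\}$ is the polynomial ring over $k$ in the differential variables $\Theta Y=\{\theta y_j\}$. $[F]$ is the differential ideal generated by $F$. A ranking is a total order on $\Theta Y$ such that $\theta u\geq u$ and ($u\geq v\Rightarrow\theta u\geq\theta v$). The leader $u_f$ of $f\notin k$ is the highest differential variable in $f$; if $d=\deg_{u_f}f$, the initial $I_f$ is the coefficient of $u_f^d$, the separant is $S_f=\partial f/\partial u_f$, and the rank is $u_f^d$. Ranks are compared by $u^{d}>v^{e}$ iff $u>v$, or $u=v$ and $d>e$. $f$ is reduced with respect to $g$ if no proper derivative of $u_g$ appears in $f$ and $\deg_{u_g}f<\deg_{u_g}g$. A set $\mathbb{A}\subset k\{Y\}\setminus k$ is autoreduced if each element is reduced with respect to all the others; such sets are finite and written in order of increasing rank. $\mathbb{A}=A_1,\ldots,A_r$ has lower rank than $\mathbb{B}=B_1,\ldots,B_s$ if there is $j\le r,s$ with $\operatorname{rank}A_i=\operatorname{rank}B_i$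 for $i<j$ and $\operatorname{rank}A_j<\operatorname{rank}B_j$, or if $r>s$ and $\operatorname{rank}A_i=\operatorname{rank}B_i$ for $1\le i\le s$. A characteristic set of an ideal is an autoreduced subset of it of lowest rank. $H_{\mathbb{A}}$ is the product of the initials and separants of the elements of $\mathbb{A}$, and $J:H_{\mathbb{A}}^\infty=\{a : H_{\mathbb{A}}^m a\in J\text{ for some }m\geq0\}$. A differential ideal $I$ is characterizable if $I=[\mathbb{A}]:H_{\mathbb{A}}^\infty$ for some characteristic set $\mathbb{A}$ of $I$. All characteristic sets of $I$ have the same set of leaders $L$; the set of non-leaders is $N=\Theta Y\setminus\Theta L$. $>_{\rm lex}$ is the lexicographic order on power products of differential variables induced by the ranking. A characteristic set $\mathbb{C}=C_1,\ldots,C_p$ of a characterizable ideal $I$ is canonical if (1) $I_{C_i}\in k[N]$ for all $i$; (2) for each $i$, $C_i$ has no factors in $k[N]$ (other than constants of $k$), and the coefficient in $I_{C_i}$ of its leading monomial with respect to $>_{\rm lex}$ equals $1$. The canonical characteristic set exists and is unique. *)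

theory Defs
  imports "HOL-Library.Poly_Mapping"
begin

text \<open>
  The type \<open>'d\<close> indexes the derivations, the type \<open>'y\<close> the differential indeterminates, and
  \<open>'k\<close> is the coefficient field.  A derivative operator is its exponent vector, so \<open>(\<theta>, j)\<close>
  stands for the differential variable \<open>\<theta> y\<^sub>j\<close>.
\<close>

type_synonym 'd dop = "'d \<Rightarrow>\<^sub>0 nat"
type_synonym ('d, 'y) dvar = "'d dop \<times> 'y"
type_synonym ('d, 'y) dmonom = "('d, 'y) dvar \<Rightarrow>\<^sub>0 nat"
type_synonym ('d, 'y, 'k) dpoly = "('d, 'y) dmonom \<Rightarrow>\<^sub>0 'k"

section \<open>Differential polynomials\<close>

definition differential_field :: "('d \<Rightarrow> 'k::field \<Rightarrow> 'k) \<Rightarrow> bool" where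
  "differential_field \<delta> \<longleftrightarrow>
     (\<forall>i a b. \<delta> i (a + b) = \<delta> i a + \<delta> i b) \<and>
     (\<forall>i a b. \<delta> i (a * b) = \<delta> i a * b + a * \<delta> i b) \<and>
     (\<forall>i j a. \<delta> i (\<delta> j a) = \<delta> j (\<delta> i a))"

definition apply_dop :: "'d dop \<Rightarrow> ('d, 'y) dvar \<Rightarrow> ('d, 'y) dvar" where
  "apply_dop \<theta> u = (\<theta> + fst u, snd u)"

definition Const :: "'k::zero \<Rightarrow> ('d, 'y, 'k) dpoly" where
  "Const c = Poly_Mapping.single 0 c"

definition Var :: "('d, 'y) dvar \<Rightarrow> ('d, 'y, 'k::zero_neq_one) dpoly" where
  "Var u = Poly_Mapping.single (Poly_Mapping.single u 1) 1"

definition vars :: "('d, 'y, 'k::zero) dpoly \<Rightarrow> ('d, 'y) dvar set" where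
  "vars p = (\<Union>m\<in>Poly_Mapping.keys p. Poly_Mapping.keys m)"

definition polys_in :: "('d, 'y) dvar set \<Rightarrow> ('d, 'y, 'k::zero) dpoly set" where
  "polys_in V = {p. vars p \<subseteq> V}"

definition deg_in :: "('d, 'y) dvar \<Rightarrow> ('d, 'y, 'k::zero) dpoly \<Rightarrow> nat" where
  "deg_in u p = Max (insert 0 ((\<lambda>m. Poly_Mapping.lookup m u) ` Poly_Mapping.keys p))"

text \<open>The coefficient of \<open>u\<^sup>d\<close> in \<open>p\<close>, viewed as a polynomial in \<open>u\<close>.\<close>

definition coeff_in ::
    "('d, 'y) dvar \<Rightarrow> nat \<Rightarrow> ('d, 'y, 'k::comm_monoid_add) dpoly \<Rightarrow> ('d, 'y, 'k) dpoly" where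
  "coeff_in u d p =
     (\<Sum>m\<in>{m \<in> Poly_Mapping.keys p. Poly_Mapping.lookup m u = d}.
        Poly_Mapping.single (m - Poly_Mapping.single u d) (Poly_Mapping.lookup p m))"

definition pderiv_in ::
    "('d, 'y) dvar \<Rightarrow> ('d, 'y, 'k::comm_semiring_1) dpoly \<Rightarrow> ('d, 'y, 'k) dpoly" where
  "pderiv_in u p =
     (\<Sum>m\<in>Poly_Mapping.keys p.
        Poly_Mapping.single (m - Poly_Mapping.single u 1)
          (of_nat (Poly_Mapping.lookup m u) * Poly_Mapping.lookup p m))"

text \<open>
  The extension of \<open>\<delta> i\<close> to differential polynomials: apply \<open>\<delta> i\<close> to the coefficients and add,
  by the chain rule, the contributions of the differential variables.
\<close>

definition dderiv ::
    "('d \<Rightarrow> 'k \<Rightarrow> 'k) \<Rightarrow> 'd \<Rightarrow> ('d, 'y, 'k::comm_semiring_1) dpoly \<Rightarrow> ('d, 'y, 'k) dpoly" where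
  "dderiv \<delta> i p =
     Poly_Mapping.map (\<delta> i) p +
     (\<Sum>u\<in>vars p. pderiv_in u p * Var (apply_dop (Poly_Mapping.single i 1) u))"

definition differential_ideal ::
    "('d \<Rightarrow> 'k \<Rightarrow> 'k) \<Rightarrow> ('d, 'y, 'k::comm_ring_1) dpoly set \<Rightarrow> bool" where
  "differential_ideal \<delta> J \<longleftrightarrow>
     0 \<in> J \<and>
     (\<forall>a\<in>J. \<forall>b\<in>J. a + b \<in> J) \<and>
     (\<forall>r. \<forall>a\<in>J. r * a \<in> J) \<and>
     (\<forall>i. \<forall>a\<in>J. dderiv \<delta> i a \<in> J)"

definition differential_ideal_gen ::
    "('d \<Rightarrow> 'k \<Rightarrow> 'k) \<Rightarrow> ('d, 'y, 'k::comm_ring_1) dpoly set \<Rightarrow> ('d, 'y, 'k) dpoly set" where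
  "differential_ideal_gen \<delta> F = \<Inter>{J. differential_ideal \<delta> J \<and> F \<subseteq> J}"

definition saturation ::
    "('d, 'y, 'k::comm_ring_1) dpoly set \<Rightarrow> ('d, 'y, 'k) dpoly \<Rightarrow> ('d, 'y, 'k) dpoly set" where
  "saturation J h = {a. \<exists>m::nat. h ^ m * a \<in> J}"

section \<open>Rankings\<close>

type_synonym ('d, 'y) dorder = "('d, 'y) dvar \<Rightarrow> ('d, 'y) dvar \<Rightarrow> bool"

text \<open>\<open>le u v\<close> stands for \<open>u \<le> v\<close>.\<close>

abbreviation strict :: "('d, 'y) dorder \<Rightarrow> ('d, 'y) dorder" where
  "strict le u v \<equiv> le u v \<and> u \<noteq> v"

definition ranking :: "('d, 'y) dorder \<Rightarrow> bool" where
  "ranking le \<longleftrightarrow>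
     class.linorder le (strict le) \<and>
     (\<forall>\<theta> u. le u (apply_dop \<theta> u)) \<and>
     (\<forall>\<theta> u v. le v u \<longrightarrow> le (apply_dop \<theta> v) (apply_dop \<theta> u))"

definition leader :: "('d, 'y) dorder \<Rightarrow> ('d, 'y, 'k::zero) dpoly \<Rightarrow> ('d, 'y) dvar" where
  "leader le f = (THE u. u \<in> vars f \<and> (\<forall>v\<in>vars f. le v u))"

definition initial ::
    "('d, 'y) dorder \<Rightarrow> ('d, 'y, 'k::comm_monoid_add) dpoly \<Rightarrow> ('d, 'y, 'k) dpoly" where
  "initial le f = coeff_in (leader le f) (deg_in (leader le f) f) f"

definition separant ::
    "('d, 'y) dorder \<Rightarrow> ('d, 'y, 'k::comm_semiring_1) dpoly \<Rightarrow> ('d, 'y, 'k) dpoly" where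
  "separant le f = pderiv_in (leader le f) f"

text \<open>The rank \<open>u\<^sup>d\<close> is represented by the pair \<open>(u, d)\<close>.\<close>

definition rank :: "('d, 'y) dorder \<Rightarrow> ('d, 'y, 'k::zero) dpoly \<Rightarrow> ('d, 'y) dvar \<times> nat" where
  "rank le f = (leader le f, deg_in (leader le f) f)"

definition rank_less ::
    "('d, 'y) dorder \<Rightarrow> ('d, 'y) dvar \<times> nat \<Rightarrow> ('d, 'y) dvar \<times> nat \<Rightarrow> bool" where
  "rank_less le r s \<longleftrightarrow> strict le (fst r) (fst s) \<or> fst r = fst s \<and> snd r < snd s"

section \<open>Autoreduced sets and characteristic sets\<close>

definition reduced ::
    "('d, 'y) dorder \<Rightarrow> ('d, 'y, 'k::zero) dpoly \<Rightarrow> ('d, 'y, 'k) dpoly \<Rightarrow> bool" where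
  "reduced le f g \<longleftrightarrow>
     (\<forall>\<theta>. \<theta> \<noteq> 0 \<longrightarrow> apply_dop \<theta> (leader le g) \<notin> vars f) \<and>
     deg_in (leader le g) f < deg_in (leader le g) g"

definition autoreduced :: "('d, 'y) dorder \<Rightarrow> ('d, 'y, 'k::zero) dpoly set \<Rightarrow> bool" where
  "autoreduced le A \<longleftrightarrow>
     A \<inter> range Const = {} \<and> (\<forall>f\<in>A. \<forall>g\<in>A. f \<noteq> g \<longrightarrow> reduced le f g)"

text \<open>
  Autoreduced sets are finite and their elements have pairwise distinct ranks, so each is the
  set of elements of exactly one list with strictly increasing ranks.  From here on,
  autoreduced sets are represented by these lists.
\<close>

definition autoreduced_list :: "('d, 'y) dorder \<Rightarrow> ('d, 'y, 'k::zero) dpoly list \<Rightarrow> bool" where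
  "autoreduced_list le As \<longleftrightarrow>
     autoreduced le (set As) \<and> sorted_wrt (\<lambda>f g. rank_less le (rank le f) (rank le g)) As"

definition lower_rank ::
    "('d, 'y) dorder \<Rightarrow> ('d, 'y, 'k::zero) dpoly list \<Rightarrow> ('d, 'y, 'k) dpoly list \<Rightarrow> bool" where
  "lower_rank le As Bs \<longleftrightarrow>
     (\<exists>j. j < length As \<and> j < length Bs \<and>
          (\<forall>i<j. rank le (As ! i) = rank le (Bs ! i)) \<and>
          rank_less le (rank le (As ! j)) (rank le (Bs ! j))) \<or>
     (length As > length Bs \<and> (\<forall>i<length Bs. rank le (As ! i) = rank le (Bs ! i)))"

definition characteristic_set ::
    "('d, 'y) dorder \<Rightarrow> ('d, 'y, 'k::zero) dpoly set \<Rightarrow> ('d, 'y, 'k) dpoly list \<Rightarrow> bool" where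
  "characteristic_set le I As \<longleftrightarrow>
     autoreduced_list le As \<and> set As \<subseteq> I \<and>
     \<not> (\<exists>Bs. autoreduced_list le Bs \<and> set Bs \<subseteq> I \<and> lower_rank le Bs As)"

definition H_prod ::
    "('d, 'y) dorder \<Rightarrow> ('d, 'y, 'k::comm_ring_1) dpoly list \<Rightarrow> ('d, 'y, 'k) dpoly" where
  "H_prod le As = (\<Prod>f\<leftarrow>As. initial le f * separant le f)"

definition characterizable ::
    "('d \<Rightarrow> 'k \<Rightarrow> 'k) \<Rightarrow> ('d, 'y) dorder \<Rightarrow> ('d, 'y, 'k::comm_ring_1) dpoly set \<Rightarrow> bool" where
  "characterizable \<delta> le I \<longleftrightarrow>
     differential_ideal \<delta> I \<and>
     (\<exists>As. characteristic_set le I As \<and>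
           I = saturation (differential_ideal_gen \<delta> (set As)) (H_prod le As))"

text \<open>
  All characteristic sets of an ideal have the same leaders, so the union below is
  the set of leaders of any one of them.
\<close>

definition leaders :: "('d, 'y) dorder \<Rightarrow> ('d, 'y, 'k::zero) dpoly set \<Rightarrow> ('d, 'y) dvar set" where
  "leaders le I = (\<Union>As\<in>{As. characteristic_set le I As}. leader le ` set As)"

definition nonleaders ::
    "('d, 'y) dorder \<Rightarrow> ('d, 'y, 'k::zero) dpoly set \<Rightarrow> ('d, 'y) dvar set" where
  "nonleaders le I = - {apply_dop \<theta> u | \<theta> u. u \<in> leaders le I}"

section \<open>Canonical characteristic sets\<close>

definition lex_less ::
    "('d, 'y) dorder \<Rightarrow> ('d, 'y) dmonom \<Rightarrow> ('d, 'y) dmonom \<Rightarrow> bool" where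
  "lex_less le s t \<longleftrightarrow>
     (\<exists>u. Poly_Mapping.lookup s u < Poly_Mapping.lookup t u \<and>
          (\<forall>v. strict le u v \<longrightarrow> Poly_Mapping.lookup s v = Poly_Mapping.lookup t v))"

definition lex_lead_monom :: "('d, 'y) dorder \<Rightarrow> ('d, 'y, 'k::zero) dpoly \<Rightarrow> ('d, 'y) dmonom" where
  "lex_lead_monom le p =
     (THE m. m \<in> Poly_Mapping.keys p \<and>
             (\<forall>m'\<in>Poly_Mapping.keys p. m' \<noteq> m \<longrightarrow> lex_less le m' m))"

definition lex_lead_coeff :: "('d, 'y) dorder \<Rightarrow> ('d, 'y, 'k::zero) dpoly \<Rightarrow> 'k" where
  "lex_lead_coeff le p = Poly_Mapping.lookup p (lex_lead_monom le p)"

definition canonical_characteristic_set ::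
    "('d, 'y) dorder \<Rightarrow> ('d, 'y, 'k::comm_ring_1) dpoly set \<Rightarrow> ('d, 'y, 'k) dpoly list \<Rightarrow> bool" where
  "canonical_characteristic_set le I Cs \<longleftrightarrow>
     characteristic_set le I Cs \<and>
     (\<forall>f\<in>set Cs.
        initial le f \<in> polys_in (nonleaders le I) \<and>
        (\<forall>q\<in>polys_in (nonleaders le I). q dvd f \<longrightarrow> q \<in> range Const) \<and>
        lex_lead_coeff le (initial le f) = 1)"

end

(*
  Elements B and C of the same rank in two characteristic sets of I with initials in k[N]
  satisfy I_C * B = I_B * C: the difference lies in I and is reduced with respect to both sets,
  hence is a constant, and 1 is not in I.  If C has no nonconstant factor in k[N], unique
  factorization gives that I_C divides I_B.

  That 1 is not in I needs characterizability: a characteristic set of the unit ideal consists of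
  polynomials a_j y_j + b_j with constants a_j, so evaluating y_j at -b_j/a_j gives a differential
  homomorphism that annihilates [A] but not H_A.
*)
theory Submission
  imports Defs "HOL-Computational_Algebra.Factorial_Ring"
begin

section \<open>Polynomials as univariate polynomials in one variable\<close>

text \<open>Minimality of rank cannot by itself show that the combination of B and C vanishes:
  autoreduced sets contain no constants, so a characteristic set never rules out a nonzero constant
  in its ideal. This is where the saturation in the definition of characterizability enters. The
  evaluation used there must respect derivations: once y_j has a value, the values of all its
  derivatives are forced, and they are consistent because the derivations commute.

  There are infinitely many differential variables, whereas factorization is handled by induction on
  variables. One divisibility involves only finitely many of them, so primality is first proved over
  a finite variable set. No variable cancels in a nonzero product; hence factors of nonzero elements
  of k[N] stay in k[N], and divisibility can always be taken in the full ring. The quotient of the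
  initials is then reached without greatest common divisors: an irreducible factor of I_C lies in
  k[N], cannot divide C, so divides I_B and cancels.\<close>

lemma sum_single_lookup: "(\<Sum>m\<in>Poly_Mapping.keys p. Poly_Mapping.single m (Poly_Mapping.lookup p m)) = p"
  by (rule poly_mapping_eqI)
    (simp add: lookup_sum lookup_single when_def in_keys_iff)

text \<open>The rule serves at two levels: polynomials are sums of terms, and exponent vectors are
  sums of multiples of unit vectors. Biadditive identities thereby reduce to monomials.\<close>

lemma poly_mapping_single_induct [case_names zero single add]:
  fixes p :: "'a \<Rightarrow>\<^sub>0 'b::comm_monoid_add"
  assumes "P 0" and "\<And>m c. P (Poly_Mapping.single m c)" and "\<And>p q. P p \<Longrightarrow> P q \<Longrightarrow> P (p + q)"
  shows "P p"
proof -
  have "P (\<Sum>m\<in>M. Poly_Mapping.single m (Poly_Mapping.lookup p m))" if "finite M" for M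
    using that by induction (use assms in auto)
  from this[OF finite_keys, of p] show ?thesis
    by (simp only: sum_single_lookup)
qed

lemma minus_single_add_single:
  fixes m :: "'a \<Rightarrow>\<^sub>0 nat"
  shows "m - Poly_Mapping.single u (Poly_Mapping.lookup m u) + Poly_Mapping.single u (Poly_Mapping.lookup m u) = m"
  by (rule poly_mapping_eqI) (simp add: lookup_add lookup_minus lookup_single when_def)

lemma lookup_coeff_in:
  "Poly_Mapping.lookup (coeff_in u d p) m =
    (if Poly_Mapping.lookup m u = 0 then Poly_Mapping.lookup p (m + Poly_Mapping.single u d) else 0)"
proof -
  let ?K = "{m \<in> Poly_Mapping.keys p. Poly_Mapping.lookup m u = d}"
  \<comment> \<open>Subtraction of exponents is truncated; it can be undone here because the
    exponent of \<open>u\<close> in \<open>n\<close> is exactly \<open>d\<close>.\<close>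
  have eq: "n - Poly_Mapping.single u d = m \<longleftrightarrow>
      Poly_Mapping.lookup m u = 0 \<and> n = m + Poly_Mapping.single u d"
    if "Poly_Mapping.lookup n u = d" for n
  proof
    assume "n - Poly_Mapping.single u d = m"
    then show "Poly_Mapping.lookup m u = 0 \<and> n = m + Poly_Mapping.single u d"
      using that by (auto intro!: poly_mapping_eqI simp: lookup_add lookup_minus lookup_single when_def)
  qed (auto intro!: poly_mapping_eqI simp: lookup_add lookup_minus)
  have "Poly_Mapping.lookup (coeff_in u d p) m =
      (\<Sum>n\<in>?K. if n - Poly_Mapping.single u d = m then Poly_Mapping.lookup p n else 0)"
    by (simp add: coeff_in_def lookup_sum lookup_single when_def)
  also have "\<dots> = (\<Sum>n\<in>?K. if Poly_Mapping.lookup m u = 0 \<and> n = m + Poly_Mapping.single u d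
      then Poly_Mapping.lookup p n else 0)"
    by (rule sum.cong) (simp_all add: eq)
  also have "\<dots> = (if Poly_Mapping.lookup m u = 0 then Poly_Mapping.lookup p (m + Poly_Mapping.single u d) else 0)"
  proof (cases "Poly_Mapping.lookup m u = 0")
    case True
    moreover have "finite ?K" by simp
    ultimately show ?thesis
      by (simp add: sum.delta lookup_add in_keys_iff)
  qed simp
  finally show ?thesis .
qed

lemma coeff_in_0 [simp]: "coeff_in u d 0 = 0"
  by (simp add: coeff_in_def)

lemma coeff_in_add: "coeff_in u d (p + q) = coeff_in u d p + coeff_in u d q"
  by (rule poly_mapping_eqI) (simp add: lookup_coeff_in lookup_add)

lemma coeff_in_diff:
  fixes p q :: "('d, 'y, 'k::comm_ring_1) dpoly"
  shows "coeff_in u d (p - q) = coeff_in u d p - coeff_in u d q"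
  by (rule poly_mapping_eqI) (simp add: lookup_coeff_in lookup_minus)

lemma coeff_in_single:
  "coeff_in u d (Poly_Mapping.single s c) =
    (if Poly_Mapping.lookup s u = d then Poly_Mapping.single (s - Poly_Mapping.single u d) c else 0)"
proof -
  have "{m \<in> Poly_Mapping.keys (Poly_Mapping.single s c). Poly_Mapping.lookup m u = d} =
    (if c \<noteq> 0 \<and> Poly_Mapping.lookup s u = d then {s} else {})"
    by auto
  then show ?thesis by (simp add: coeff_in_def)
qed

text \<open>Both sides are additive in \<open>p\<close> and in \<open>q\<close>, so the Cauchy
  product formula need only be checked on two terms, where a single index of the sum
  survives.\<close>

lemma coeff_in_mult:
  fixes p q :: "('d, 'y, 'k::comm_semiring_1) dpoly"
  shows "coeff_in u n (p * q) = (\<Sum>i\<le>n. coeff_in u i p * coeff_in u (n - i) q)"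
proof (induction p rule: poly_mapping_single_induct)
  case (single s c)
  show ?case
  proof (induction q rule: poly_mapping_single_induct)
    case (single t d)
    have eq: "s + t - Poly_Mapping.single u (Poly_Mapping.lookup s u + Poly_Mapping.lookup t u) =
      s - Poly_Mapping.single u (Poly_Mapping.lookup s u) + (t - Poly_Mapping.single u (Poly_Mapping.lookup t u))"
      by (rule poly_mapping_eqI) (simp add: lookup_add lookup_minus lookup_single when_def)
    let ?s = "Poly_Mapping.lookup s u" and ?t = "Poly_Mapping.lookup t u"
    have "(\<Sum>i\<le>n. coeff_in u i (Poly_Mapping.single s c) * coeff_in u (n - i) (Poly_Mapping.single t d)) =
       (\<Sum>i\<le>n. if i = ?s then (if n - ?s = ?t then
          Poly_Mapping.single (s - Poly_Mapping.single u ?s + (t - Poly_Mapping.single u ?t)) (c * d) else 0) else 0)"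
      by (rule sum.cong) (auto simp: coeff_in_single mult_single)
    also have "\<dots> = (if ?s + ?t = n then
        Poly_Mapping.single (s + t - Poly_Mapping.single u (?s + ?t)) (c * d) else 0)"
      unfolding eq by auto
    also have "\<dots> = coeff_in u n (Poly_Mapping.single s c * Poly_Mapping.single t d)"
      by (simp add: coeff_in_single mult_single lookup_add)
    finally show ?case ..
  qed (simp_all add: distrib_left coeff_in_add sum.distrib)
qed (simp_all add: distrib_right coeff_in_add sum.distrib)

lemma Var_power: "Var u ^ n = Poly_Mapping.single (Poly_Mapping.single u n) (1::'k::comm_semiring_1)"
  by (induction n) (simp_all add: Var_def mult_single single_add[symmetric])

section \<open>Degree in one variable\<close>

lemma lookup_le_deg_in: "m \<in> Poly_Mapping.keys p \<Longrightarrow> Poly_Mapping.lookup m u \<le> deg_in u p"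
  by (simp add: deg_in_def)

lemma deg_in_attained:
  assumes "p \<noteq> 0"
  obtains m where "m \<in> Poly_Mapping.keys p" "Poly_Mapping.lookup m u = deg_in u p"
proof -
  let ?D = "(\<lambda>m. Poly_Mapping.lookup m u) ` Poly_Mapping.keys p"
  have "?D \<noteq> {}" using assms by simp
  then have "deg_in u p = Max ?D" by (simp add: deg_in_def)
  also have "\<dots> \<in> ?D" using \<open>?D \<noteq> {}\<close> by (intro Max_in) auto
  finally show ?thesis using that by force
qed

lemma deg_in_le_iff: "deg_in u p \<le> n \<longleftrightarrow> (\<forall>m\<in>Poly_Mapping.keys p. Poly_Mapping.lookup m u \<le> n)"
  by (simp add: deg_in_def)

lemma coeff_in_eq_0:
  assumes "deg_in u p < d"
  shows "coeff_in u d p = 0"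
proof -
  have "{m \<in> Poly_Mapping.keys p. Poly_Mapping.lookup m u = d} = {}"
    using assms lookup_le_deg_in[of _ p u] by (auto dest!: lookup_le_deg_in[of _ p u])
  then show ?thesis unfolding coeff_in_def by (simp only: sum.empty)
qed

lemma lookup_eq_lookup_coeff_in:
  "Poly_Mapping.lookup p m =
    Poly_Mapping.lookup (coeff_in u (Poly_Mapping.lookup m u) p) (m - Poly_Mapping.single u (Poly_Mapping.lookup m u))"
  by (simp add: lookup_coeff_in lookup_minus minus_single_add_single)

lemma coeff_in_deg_in_neq_0: 
  assumes "p \<noteq> 0"
  shows "coeff_in u (deg_in u p) p \<noteq> 0"
proof -
  obtain m where "m \<in> Poly_Mapping.keys p" "Poly_Mapping.lookup m u = deg_in u p"
    using deg_in_attained[OF assms] .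
  then show ?thesis
    using lookup_eq_lookup_coeff_in[of p m u] by (auto simp: in_keys_iff)
qed

lemma deg_in_eqI:
  assumes "coeff_in u n p \<noteq> 0" "\<And>i. i > n \<Longrightarrow> coeff_in u i p = 0"
  shows "deg_in u p = n"
proof (rule antisym)
  have "p \<noteq> 0" using assms(1) by auto
  then show "deg_in u p \<le> n"
    using assms(2) coeff_in_deg_in_neq_0[of p u] not_le by blast
  show "n \<le> deg_in u p"
    using assms(1) coeff_in_eq_0[of u p n] not_le by blast
qed

text \<open>The zero polynomial has degree 0 by convention, which is why \<open>n\<close> must be
  positive.\<close>

lemma deg_in_less:
  assumes "\<And>i. i \<ge> n \<Longrightarrow> coeff_in u i p = 0" "n > 0"
  shows "deg_in u p < n"
proof (cases "p = 0")
  case True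
  then show ?thesis using assms by (simp add: deg_in_def)
next
  case False
  then show ?thesis using assms coeff_in_deg_in_neq_0[of p u] not_le by blast
qed

lemma coeff_in_expansion:
  fixes p :: "('d, 'y, 'k::comm_semiring_1) dpoly"
  assumes "deg_in u p \<le> n"
  shows "p = (\<Sum>i\<le>n. coeff_in u i p * Var u ^ i)"
proof -
  have "(\<Sum>i\<le>n. coeff_in u i p * Var u ^ i) =
     (\<Sum>i\<le>n. \<Sum>m | m \<in> Poly_Mapping.keys p \<and> Poly_Mapping.lookup m u = i.
        Poly_Mapping.single m (Poly_Mapping.lookup p m))"
  proof (intro sum.cong refl)
    fix i
    show "coeff_in u i p * Var u ^ i = (\<Sum>m | m \<in> Poly_Mapping.keys p \<and> Poly_Mapping.lookup m u = i.
        Poly_Mapping.single m (Poly_Mapping.lookup p m))"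
      by (auto simp: coeff_in_def Var_power sum_distrib_right mult_single minus_single_add_single
          intro!: sum.cong)
  qed
  also have "\<dots> = (\<Sum>m\<in>Poly_Mapping.keys p. Poly_Mapping.single m (Poly_Mapping.lookup p m))"
    using assms by (intro sum.group) (auto simp: deg_in_le_iff)
  finally show ?thesis by (simp add: sum_single_lookup)
qed

section \<open>Variables occurring in a polynomial\<close>

lemma finite_vars [simp]: "finite (vars p)"
  by (simp add: vars_def)

lemma vars_0 [simp]: "vars 0 = {}"
  and vars_1 [simp]: "vars (1 :: ('d, 'y, 'k::comm_semiring_1) dpoly) = {}"
  and vars_Const [simp]: "vars (Const c) = {}"
  and vars_Var [simp]: "vars (Var u :: ('d, 'y, 'k::comm_semiring_1) dpoly) = {u}"
  by (simp_all add: vars_def Const_def Var_def)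

lemma vars_diff:
  fixes p q :: "('d, 'y, 'k::comm_ring_1) dpoly"
  shows "vars (p - q) \<subseteq> vars p \<union> vars q"
  by (fastforce simp: vars_def in_keys_iff lookup_minus)

lemma vars_mult_subset:
  fixes p q :: "('d, 'y, 'k::comm_semiring_1) dpoly"
  shows "vars (p * q) \<subseteq> vars p \<union> vars q"
proof
  fix u assume "u \<in> vars (p * q)"
  then obtain m where "m \<in> Poly_Mapping.keys (p * q)" "u \<in> Poly_Mapping.keys m"
    by (auto simp: vars_def)
  moreover obtain a b where "m = a + b" "a \<in> Poly_Mapping.keys p" "b \<in> Poly_Mapping.keys q"
    using keys_mult[of p q] \<open>m \<in> _\<close> by auto
  ultimately show "u \<in> vars p \<union> vars q"
    using keys_add[of a b] by (auto simp: vars_def)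
qed

lemma vars_coeff_in: "vars (coeff_in u d p) \<subseteq> vars p - {u}"
proof
  fix v assume "v \<in> vars (coeff_in u d p)"
  then obtain m where m: "m \<in> Poly_Mapping.keys (coeff_in u d p)" and v: "v \<in> Poly_Mapping.keys m"
    unfolding vars_def by blast
  have u: "Poly_Mapping.lookup m u = 0" and mem: "m + Poly_Mapping.single u d \<in> Poly_Mapping.keys p"
    using m by (simp_all add: in_keys_iff lookup_coeff_in split: if_splits)
  have "v \<in> Poly_Mapping.keys (m + Poly_Mapping.single u d)"
    using v by (simp add: in_keys_iff lookup_add)
  then have "v \<in> vars p"
    using mem unfolding vars_def by blast
  moreover have "v \<noteq> u"
    using u v by (auto simp: in_keys_iff)
  ultimately show "v \<in> vars p - {u}" by blast
qed

lemma deg_in_eq_0_iff: "deg_in u p = 0 \<longleftrightarrow> u \<notin> vars p"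
  using deg_in_le_iff[of u p 0] by (auto simp: vars_def in_keys_iff)

lemma vars_empty_iff: "vars p = {} \<longleftrightarrow> p \<in> range Const"
proof
  assume "vars p = {}"
  then have "Poly_Mapping.keys p \<subseteq> {0}"
    by (auto simp: vars_def)
  then have "p = Const (Poly_Mapping.lookup p 0)"
    by (intro poly_mapping_eqI) (auto simp: Const_def lookup_single when_def in_keys_iff)
  then show "p \<in> range Const" by blast
qed auto

lemma coeff_in_notin_vars:
  assumes "u \<notin> vars p"
  shows "coeff_in u d p = (if d = 0 then p else 0)"
proof (cases d)
  case 0
  have "m \<notin> Poly_Mapping.keys p" if "Poly_Mapping.lookup m u \<noteq> 0" for m
    using assms that by (auto simp: vars_def in_keys_iff[of u])
  then have "Poly_Mapping.lookup p m = 0" if "Poly_Mapping.lookup m u \<noteq> 0" for m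
    using that by (simp add: in_keys_iff)
  then have "coeff_in u 0 p = p"
    by (intro poly_mapping_eqI) (simp add: lookup_coeff_in)
  with 0 show ?thesis by simp
next
  case (Suc n)
  then show ?thesis
    using assms deg_in_eq_0_iff[of u p] coeff_in_eq_0[of u p d] by simp
qed

lemma coeff_in_mult_notin_vars:
  fixes p q :: "('d, 'y, 'k::comm_semiring_1) dpoly"
  assumes "u \<notin> vars p"
  shows "coeff_in u d (p * q) = p * coeff_in u d q"
proof -
  have "coeff_in u d (p * q) = (\<Sum>i\<le>d. if i = 0 then p * coeff_in u d q else 0)"
    unfolding coeff_in_mult by (rule sum.cong) (simp_all add: coeff_in_notin_vars[OF assms])
  then show ?thesis by simp
qed

text \<open>A polynomial free of \<open>u\<close> acts as a scalar on the coefficients in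
  \<open>u\<close>. This replaces the notion of content in Gauss's lemma.\<close>

lemma dvd_iff_dvd_coeff_in:
  fixes p q :: "('d, 'y, 'k::comm_semiring_1) dpoly"
  assumes "u \<notin> vars p"
  shows "p dvd q \<longleftrightarrow> (\<forall>i. p dvd coeff_in u i q)"
proof
  assume "p dvd q"
  then show "\<forall>i. p dvd coeff_in u i q"
    by (auto simp: coeff_in_mult_notin_vars[OF assms])
next
  assume "\<forall>i. p dvd coeff_in u i q"
  then have "p dvd (\<Sum>i\<le>deg_in u q. coeff_in u i q * Var u ^ i)"
    by (auto intro: dvd_sum)
  then show "p dvd q" using coeff_in_expansion[of u q] by simp
qed

text \<open>In every other term of the Cauchy product one index exceeds its bound. Upper bounds in
  place of exact degrees suffice for this.\<close>

lemma coeff_in_mult_deg_in: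
  fixes p q :: "('d, 'y, 'k::comm_semiring_1) dpoly"
  assumes "deg_in u p \<le> i" "deg_in u q \<le> j"
  shows "coeff_in u (i + j) (p * q) = coeff_in u i p * coeff_in u j q"
proof -
  have "coeff_in u (i + j) (p * q) = (\<Sum>l\<le>i+j. if l = i then coeff_in u i p * coeff_in u j q else 0)"
    unfolding coeff_in_mult
  proof (rule sum.cong)
    fix l assume "l \<in> {..i+j}"
    then show "coeff_in u l p * coeff_in u (i + j - l) q =
      (if l = i then coeff_in u i p * coeff_in u j q else 0)"
      using assms coeff_in_eq_0[of u p l] coeff_in_eq_0[of u q "i + j - l"]
      by (cases l i rule: linorder_cases) auto
  qed simp
  then show ?thesis by simp
qed

lemma coeff_in_mult_eq_0:
  fixes p q :: "('d, 'y, 'k::comm_semiring_1) dpoly"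
  assumes "deg_in u p + deg_in u q < n"
  shows "coeff_in u n (p * q) = 0"
  unfolding coeff_in_mult
proof (rule sum.neutral, intro ballI)
  fix i
  have "deg_in u p < i \<or> deg_in u q < n - i" using assms by linarith
  then show "coeff_in u i p * coeff_in u (n - i) q = 0"
    using coeff_in_eq_0[of u p i] coeff_in_eq_0[of u q "n - i"] by auto
qed

section \<open>Constants and absence of zero divisors\<close>

lemma Const_mult: "Const (a * b) = Const a * (Const b :: ('d, 'y, 'k::comm_semiring_1) dpoly)"
  by (simp add: Const_def mult_single)

lemma Const_eq_0_iff [simp]: "Const a = 0 \<longleftrightarrow> a = 0"
  by (metis Const_def lookup_single_eq lookup_zero single_zero)

lemma Const_1: "Const 1 = (1 :: ('d, 'y, 'k::comm_semiring_1) dpoly)"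
  by (simp add: Const_def)

text \<open>Variables are removed one at a time: the leading coefficients in \<open>u\<close> omit
  \<open>u\<close>, and their product is a coefficient of \<open>p * q\<close>. The induction ends
  at constants, where the integral domain of coefficients decides.\<close>

lemma dpoly_no_zero_divisors:
  fixes p q :: "('d, 'y, 'k::idom) dpoly"
  shows "p * q = 0 \<longleftrightarrow> p = 0 \<or> q = 0"
proof -
  have "p * q \<noteq> 0" if "finite V" "vars p \<union> vars q \<subseteq> V" "p \<noteq> 0" "q \<noteq> 0"
    for V and p q :: "('d, 'y, 'k) dpoly"
    using that
  proof (induction V arbitrary: p q)
    case empty
    then obtain a b where "p = Const a" "q = Const b"
      using vars_empty_iff[of p] vars_empty_iff[of q] by auto
    with empty show ?case by (simp flip: Const_mult)
  next
    case (insert u V)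
    let ?a = "coeff_in u (deg_in u p) p" and ?b = "coeff_in u (deg_in u q) q"
    have "vars ?a \<union> vars ?b \<subseteq> V"
      using insert.prems vars_coeff_in[of u _ p] vars_coeff_in[of u _ q] by blast
    then have "?a * ?b \<noteq> 0"
      using insert.prems by (intro insert.IH coeff_in_deg_in_neq_0)
    then have "coeff_in u (deg_in u p + deg_in u q) (p * q) \<noteq> 0"
      by (simp add: coeff_in_mult_deg_in)
    then show ?case by auto
  qed
  from this[of "vars p \<union> vars q" p q] show ?thesis by auto
qed

lemma dpoly_mult_cancel:
  fixes p q r :: "('d, 'y, 'k::idom) dpoly"
  assumes "p * q = p * r" "p \<noteq> 0"
  shows "q = r"
  using assms dpoly_no_zero_divisors[of p "q - r"] by (simp add: right_diff_distrib)

lemma deg_in_mult: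
  fixes p q :: "('d, 'y, 'k::idom) dpoly"
  assumes "p \<noteq> 0" "q \<noteq> 0"
  shows "deg_in u (p * q) = deg_in u p + deg_in u q"
  using assms by (intro deg_in_eqI coeff_in_mult_eq_0)
    (simp_all add: coeff_in_mult_deg_in dpoly_no_zero_divisors coeff_in_deg_in_neq_0)

lemma vars_mult:
  fixes p q :: "('d, 'y, 'k::idom) dpoly"
  assumes "p \<noteq> 0" "q \<noteq> 0"
  shows "vars (p * q) = vars p \<union> vars q"
proof (rule set_eqI)
  fix u
  show "u \<in> vars (p * q) \<longleftrightarrow> u \<in> vars p \<union> vars q"
    using deg_in_mult[OF assms, of u] deg_in_eq_0_iff[of u "p * q"] deg_in_eq_0_iff[of u p]
      deg_in_eq_0_iff[of u q] by auto
qed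

section \<open>Unique factorization\<close>

text \<open>
  The total degree would do as an induction measure too, but the sum of the degrees in the
  single variables is additive for a simpler reason.
\<close>

definition sum_degs :: "('d, 'y, 'k::zero) dpoly \<Rightarrow> nat" where
  "sum_degs p = (\<Sum>u\<in>vars p. deg_in u p)"

lemma sum_degs_superset:
  assumes "finite V" "vars p \<subseteq> V"
  shows "sum_degs p = (\<Sum>u\<in>V. deg_in u p)"
  unfolding sum_degs_def
  by (rule sum.mono_neutral_left) (use assms in \<open>auto simp: deg_in_eq_0_iff\<close>)

lemma sum_degs_mult:
  fixes p q :: "('d, 'y, 'k::idom) dpoly"
  assumes "p \<noteq> 0" "q \<noteq> 0"
  shows "sum_degs (p * q) = sum_degs p + sum_degs q"
proof -
  let ?V = "vars p \<union> vars q"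
  have "sum_degs (p * q) = (\<Sum>u\<in>?V. deg_in u p + deg_in u q)"
    using assms by (simp add: sum_degs_def vars_mult deg_in_mult)
  also have "\<dots> = sum_degs p + sum_degs q"
    by (simp add: sum.distrib sum_degs_superset[of ?V])
  finally show ?thesis .
qed

lemma sum_degs_eq_0_iff: "sum_degs p = 0 \<longleftrightarrow> vars p = {}"
  by (auto simp: sum_degs_def deg_in_eq_0_iff)

lemma dpoly_unit_iff:
  fixes p :: "('d, 'y, 'k::field) dpoly"
  shows "p dvd 1 \<longleftrightarrow> p \<noteq> 0 \<and> vars p = {}"
proof
  assume "p dvd 1"
  then obtain q where "p * q = 1" by (metis dvdE)
  moreover from this have "p \<noteq> 0" "q \<noteq> 0" by auto
  ultimately show "p \<noteq> 0 \<and> vars p = {}"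
    using vars_mult[of p q] by simp
next
  assume "p \<noteq> 0 \<and> vars p = {}"
  then obtain c where "p = Const c" "c \<noteq> 0"
    using vars_empty_iff[of p] by auto
  then have "p * Const (inverse c) = 1"
    by (simp add: Const_1 flip: Const_mult)
  then show "p dvd 1" by (metis dvd_triv_left)
qed

text \<open>No variable cancels in a nonzero product, so factorizations found in the full ring never
  leave the polynomials in \<open>V\<close>. Zero is excluded because everything divides it.\<close>

lemma polys_in_dvd:
  fixes p q :: "('d, 'y, 'k::idom) dpoly"
  assumes "q dvd p" "p \<noteq> 0" "p \<in> polys_in V"
  shows "q \<in> polys_in V"
proof -
  obtain r where "p = q * r" using assms(1) by (rule dvdE)
  moreover from this have "q \<noteq> 0" "r \<noteq> 0" using assms(2) by auto
  ultimately show ?thesis using assms(3) vars_mult[of q r] by (simp add: polys_in_def)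
qed

lemma polys_in_mult:
  fixes p q :: "('d, 'y, 'k::comm_semiring_1) dpoly"
  shows "p \<in> polys_in V \<Longrightarrow> q \<in> polys_in V \<Longrightarrow> p * q \<in> polys_in V"
  using vars_mult_subset[of p q] by (auto simp: polys_in_def)

lemma polys_in_diff:
  fixes p q :: "('d, 'y, 'k::comm_ring_1) dpoly"
  shows "p \<in> polys_in V \<Longrightarrow> q \<in> polys_in V \<Longrightarrow> p - q \<in> polys_in V"
  using vars_diff[of p q] by (auto simp: polys_in_def)

lemma polys_in_coeff_in: "p \<in> polys_in V \<Longrightarrow> coeff_in u i p \<in> polys_in (V - {u})"
  using vars_coeff_in[of u i p] by (auto simp: polys_in_def)

text \<open>Over a field a nonzero nonunit has positive \<open>sum_degs\<close>, so each proper
  factor is smaller and the descent ends. The bound on \<open>r\<close> makes the lemma usable for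
  peeling off factors inductively.\<close>

lemma dpoly_irreducible_factor:
  fixes p :: "('d, 'y, 'k::field) dpoly"
  assumes "p \<noteq> 0" "\<not> p dvd 1"
  obtains q r where "irreducible q" "p = q * r" "r \<noteq> 0" "sum_degs r < sum_degs p"
proof -
  have "\<exists>q. irreducible q \<and> q dvd p"
    using assms
  proof (induction "sum_degs p" arbitrary: p rule: less_induct)
    case less
    show ?case
    proof (cases "irreducible p")
      case False
      then obtain a b where ab: "p = a * b" "\<not> a dvd 1" "\<not> b dvd 1"
        using less.prems by (auto simp: irreducible_def)
      have "a \<noteq> 0" "b \<noteq> 0" using ab less.prems by auto
      moreover from this have "sum_degs b > 0"
        using ab sum_degs_eq_0_iff[of b] by (auto simp: dpoly_unit_iff)
      ultimately have "sum_degs a < sum_degs p"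
        using ab by (simp add: sum_degs_mult)
      then show ?thesis
        using less.hyps[of a] ab \<open>a \<noteq> 0\<close> by auto
    qed auto
  qed
  then obtain q r where q: "irreducible q" "p = q * r" unfolding dvd_def by blast
  then have "q \<noteq> 0" "r \<noteq> 0" using assms by auto
  moreover from this have "sum_degs q > 0"
    using q sum_degs_eq_0_iff[of q] dpoly_unit_iff[of q] irreducible_not_unit[of q] by auto
  ultimately have "sum_degs r < sum_degs p" using q by (simp add: sum_degs_mult)
  with that q \<open>r \<noteq> 0\<close> show ?thesis by blast
qed

lemma irreducible_dvd_irreducible:
  assumes "irreducible p" "irreducible q" "q dvd p"
  shows "p dvd q"
proof -
  obtain r where r: "p = q * r" using assms(3) by (rule dvdE)
  then have "r dvd 1"
    using irreducibleD[OF assms(1) r] irreducible_not_unit[OF assms(2)] by blast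
  then obtain s where "r * s = 1" unfolding dvd_def by metis
  then have "q = p * s" using r by (simp add: mult.assoc)
  then show ?thesis by (rule dvdI)
qed

text \<open>Primality is tested only against polynomials in \<open>V\<close>, with divisibility in
  the full ring, so that an induction on \<open>V\<close> can stay within one type.\<close>

definition prime_in :: "('d, 'y) dvar set \<Rightarrow> ('d, 'y, 'k::comm_semiring_1) dpoly \<Rightarrow> bool" where
  "prime_in V p \<longleftrightarrow> (\<forall>a\<in>polys_in V. \<forall>b\<in>polys_in V. p dvd a * b \<longrightarrow> p dvd a \<or> p dvd b)"

text \<open>Let \<open>a * b = p * c\<close> and let \<open>q\<close> be a prime factor of
  \<open>a\<close>. If \<open>q\<close> divides \<open>p\<close>, the two are associated and
  \<open>p\<close> divides \<open>a\<close>; otherwise \<open>q\<close> divides \<open>c\<close> and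
  cancels, leaving a smaller \<open>a\<close>.\<close>

lemma irreducible_dvd_mult_of_primes:
  fixes p :: "('d, 'y, 'k::field) dpoly"
  assumes p: "irreducible p" "p \<in> polys_in V"
    and "a \<noteq> 0" "a \<in> polys_in V" "b \<in> polys_in V" "p dvd a * b"
    and "\<And>q. irreducible q \<Longrightarrow> q dvd a \<Longrightarrow> prime_in V q"
  shows "p dvd a \<or> p dvd b"
  using assms(3-)
proof (induction "sum_degs a" arbitrary: a rule: less_induct)
  case less
  consider "a dvd 1" | "b = 0" | "\<not> a dvd 1" "b \<noteq> 0" by blast
  then show ?case
  proof cases
    case 1
    then obtain s where "s * a = 1" unfolding dvd_def by (metis mult.commute)
    then have "s * (a * b) = b" by (simp flip: mult.assoc)
    moreover have "p dvd s * (a * b)" using less.prems(4) by (rule dvd_mult)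
    ultimately have "p dvd b" by (simp only:)
    then show ?thesis ..
  next
    case 3
    obtain q a' where q: "irreducible q" "a = q * a'" "a' \<noteq> 0" "sum_degs a' < sum_degs a"
      using dpoly_irreducible_factor[OF less.prems(1) 3(1)] .
    obtain c where c: "a * b = p * c" using less.prems(4) by (rule dvdE)
    have ab: "a * b \<noteq> 0" "a * b \<in> polys_in V"
      using less.prems 3 by (auto simp: dpoly_no_zero_divisors polys_in_mult)
    have "c \<in> polys_in V"
      using polys_in_dvd[OF _ ab, of c] c by simp
    moreover have "q dvd p * c" using q(2) by (simp flip: c add: mult.assoc)
    ultimately consider "q dvd p" | "q dvd c"
      using less.prems(5)[OF q(1)] q p(2) unfolding prime_in_def by (metis dvd_triv_left)
    then show ?thesis
    proof cases
      case 1
      then have "p dvd q" using irreducible_dvd_irreducible p q by blast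
      then show ?thesis using q by simp
    next
      case 2
      then obtain c' where "c = q * c'" by (rule dvdE)
      then have "q * (a' * b) = q * (p * c')" using c q by (simp add: ac_simps)
      moreover have "q \<noteq> 0" using q by auto
      ultimately have "a' * b = p * c'" by (rule dpoly_mult_cancel)
      then have "p dvd a' * b" by simp
      moreover have "a' \<in> polys_in V"
        using polys_in_dvd[of a' a] q less.prems by simp
      ultimately have "p dvd a' \<or> p dvd b"
        using less.hyps[of a'] less.prems q by simp
      then show ?thesis using q by auto
    qed
  qed simp
qed

text \<open>
  Gauss's lemma: of each factor take the lowest coefficient in \<open>u\<close> not divisible by \<open>p\<close>.
\<close>

lemma prime_in_insert:
  fixes p :: "('d, 'y, 'k::comm_ring_1) dpoly"
  assumes "prime_in V p" "u \<notin> vars p"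
  shows "prime_in (insert u V) p"
  unfolding prime_in_def
proof (intro ballI impI, rule ccontr)
  fix a b
  assume ab: "a \<in> polys_in (insert u V)" "b \<in> polys_in (insert u V)" and dvd: "p dvd a * b"
    and "\<not> (p dvd a \<or> p dvd b)"
  then have exi: "\<exists>i. \<not> p dvd coeff_in u i a" and exj: "\<exists>j. \<not> p dvd coeff_in u j b"
    using dvd_iff_dvd_coeff_in[OF assms(2)] by blast+
  define i where "i = (LEAST i. \<not> p dvd coeff_in u i a)"
  define j where "j = (LEAST j. \<not> p dvd coeff_in u j b)"
  have i: "\<not> p dvd coeff_in u i a" "\<And>l. l < i \<Longrightarrow> p dvd coeff_in u l a"
    unfolding i_def by (use LeastI_ex[OF exi] not_less_Least in blast)+
  have j: "\<not> p dvd coeff_in u j b" "\<And>l. l < j \<Longrightarrow> p dvd coeff_in u l b"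
    unfolding j_def by (use LeastI_ex[OF exj] not_less_Least in blast)+
  \<comment> \<open>Every term left in the remaining sum contains a coefficient of \<open>a\<close>
    of index below \<open>i\<close> or one of \<open>b\<close> of index below \<open>j\<close>,
    hence is divisible by \<open>p\<close>.\<close>
  have "coeff_in u (i + j) (a * b) = coeff_in u i a * coeff_in u j b +
      (\<Sum>l\<in>{..i+j} - {i}. coeff_in u l a * coeff_in u (i + j - l) b)"
    unfolding coeff_in_mult by (subst sum.remove[of _ i]) auto
  moreover have "p dvd (\<Sum>l\<in>{..i+j} - {i}. coeff_in u l a * coeff_in u (i + j - l) b)"
  proof (rule dvd_sum)
    fix l assume "l \<in> {..i+j} - {i}"
    then have "l < i \<or> i + j - l < j" by auto
    then show "p dvd coeff_in u l a * coeff_in u (i + j - l) b" using i(2) j(2) by auto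
  qed
  moreover have "p dvd coeff_in u (i + j) (a * b)"
    using dvd dvd_iff_dvd_coeff_in[OF assms(2)] by blast
  ultimately have "p dvd coeff_in u i a * coeff_in u j b"
    by (simp add: dvd_add_left_iff)
  moreover have "coeff_in u i a \<in> polys_in V" "coeff_in u j b \<in> polys_in V"
    using ab polys_in_coeff_in[of a "insert u V" u i] polys_in_coeff_in[of b "insert u V" u j]
    by (auto simp: polys_in_def)
  ultimately show False using assms(1) i(1) j(1) by (auto simp: prime_in_def)
qed

text \<open>Cross-multiplication by the leading coefficients stands in for division: both products
  have the top coefficient \<open>lp * la\<close>. Since a vanishing remainder still has degree 0,
  \<open>p\<close> must have positive degree in \<open>u\<close>.\<close>

lemma deg_in_pseudo_remainder:
  fixes p a :: "('d, 'y, 'k::idom) dpoly"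
  assumes "deg_in u p > 0" "deg_in u p \<le> deg_in u a"
  defines "lp \<equiv> coeff_in u (deg_in u p) p" and "la \<equiv> coeff_in u (deg_in u a) a"
  shows "deg_in u (lp * a - la * (Var u ^ (deg_in u a - deg_in u p) * p)) < deg_in u a"
proof (rule deg_in_less)
  fix i assume "i \<ge> deg_in u a"
  let ?k = "deg_in u a - deg_in u p"
  have lp: "u \<notin> vars lp" and la: "u \<notin> vars la"
    unfolding lp_def la_def using vars_coeff_in by blast+
  have var: "deg_in u (Var u ^ ?k :: ('d, 'y, 'k) dpoly) = ?k" "coeff_in u ?k (Var u ^ ?k :: ('d, 'y, 'k) dpoly) = 1"
    by (simp_all add: Var_power deg_in_def coeff_in_single)
  have "coeff_in u i (lp * a - la * (Var u ^ ?k * p)) =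
      lp * coeff_in u i a - la * coeff_in u i (Var u ^ ?k * p)"
    by (simp add: coeff_in_diff coeff_in_mult_notin_vars lp la)
  also have "\<dots> = 0"
  proof (cases "i = deg_in u a")
    case True
    have "coeff_in u (?k + deg_in u p) (Var u ^ ?k * p) = lp"
      unfolding lp_def by (subst coeff_in_mult_deg_in) (simp_all add: var)
    then show ?thesis using True assms(2) by (simp add: la_def mult.commute)
  next
    case False
    then show ?thesis
      using \<open>i \<ge> _\<close> assms(2) coeff_in_mult_eq_0[of u "Var u ^ ?k" p i]
      by (simp add: var coeff_in_eq_0)
  qed
  finally show "coeff_in u i (lp * a - la * (Var u ^ ?k * p)) = 0" .
qed (use assms in auto)

text \<open>
  Zermelo's argument, which needs no fraction field: if \<open>p\<close> divides \<open>a * b\<close>, pseudo-division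
  by \<open>p\<close> makes the degree of \<open>a\<close> in \<open>u\<close> smaller than that of \<open>p\<close>; then all irreducible
  factors of \<open>a\<close> are prime by induction and cancel against the cofactor of \<open>p\<close>.
\<close>

lemma prime_in_of_irreducible:
  fixes p :: "('d, 'y, 'k::field) dpoly"
  assumes "finite V" "p \<in> polys_in V" "irreducible p"
  shows "prime_in V p"
  using assms
proof (induction V arbitrary: p)
  case empty
  then have "p dvd 1" by (auto simp: dpoly_unit_iff polys_in_def)
  with empty show ?case by (simp add: irreducible_not_unit)
next
  case (insert u V)
  let ?W = "insert u V"
  from insert.prems show ?case
  proof (induction "deg_in u p" arbitrary: p rule: less_induct)
    case (less p)
    show ?case
    proof (cases "deg_in u p = 0")
      \<comment> \<open>Here \<open>p\<close> is free of \<open>u\<close>, so the outer induction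
        hypothesis makes it prime over \<open>V\<close>, and Gauss's lemma adds
        \<open>u\<close>.\<close>
      case True
      then have "u \<notin> vars p" by (simp add: deg_in_eq_0_iff)
      moreover have "p \<in> polys_in V"
        using less.prems \<open>u \<notin> vars p\<close> by (auto simp: polys_in_def)
      ultimately show ?thesis
        using insert.IH less.prems by (intro prime_in_insert)
    next
      case False
      have small: "p dvd a \<or> p dvd b"
        if "a \<noteq> 0" "deg_in u a < deg_in u p" "a \<in> polys_in ?W" "b \<in> polys_in ?W" "p dvd a * b" for a b
      proof (rule irreducible_dvd_mult_of_primes[OF less.prems(2,1) that(1,3-)])
        fix q assume q: "irreducible q" "q dvd a"
        then obtain r where "a = q * r" unfolding dvd_def by blast
        moreover from this have "q \<noteq> 0" "r \<noteq> 0" using that(1) by auto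
        ultimately have "deg_in u q \<le> deg_in u a" by (simp add: deg_in_mult)
        then show "prime_in ?W q"
          using less.hyps[of q] q that polys_in_dvd[of q a] by auto
      qed
      have "p dvd a \<or> p dvd b"
        if "a \<in> polys_in ?W" "b \<in> polys_in ?W" "p dvd a * b" for a b
        using that
      proof (induction "deg_in u a" arbitrary: a rule: less_induct)
        case (less a)
        show ?case
        proof (cases "a = 0 \<or> deg_in u a < deg_in u p")
          case True
          then show ?thesis using small[of a b] less.prems by (cases "a = 0") auto
        next
          case ge: False
          define lp where "lp = coeff_in u (deg_in u p) p"
          define la where "la = coeff_in u (deg_in u a) a"
          let ?v = "Var u ^ (deg_in u a - deg_in u p) :: ('d, 'y, 'k) dpoly"
          define a' where "a' = lp * a - la * (?v * p)"
          have "deg_in u a' < deg_in u a"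
            unfolding a'_def lp_def la_def using ge False by (intro deg_in_pseudo_remainder) auto
          have "p \<noteq> 0" using \<open>irreducible p\<close> by auto
          have lp: "lp \<in> polys_in ?W" "lp \<noteq> 0" "deg_in u lp = 0"
            unfolding lp_def
            using polys_in_coeff_in[OF \<open>p \<in> polys_in ?W\<close>, of u] vars_coeff_in[of u _ p]
              coeff_in_deg_in_neq_0[OF \<open>p \<noteq> 0\<close>]
            by (auto simp: polys_in_def deg_in_eq_0_iff)
          have "la \<in> polys_in ?W"
            unfolding la_def using polys_in_coeff_in[OF less.prems(1), of u] by (auto simp: polys_in_def)
          moreover have "?v \<in> polys_in ?W"
            by (auto simp: Var_power polys_in_def vars_def)
          ultimately have "a' \<in> polys_in ?W"
            unfolding a'_def using lp less.prems \<open>p \<in> polys_in ?W\<close>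
            by (intro polys_in_diff polys_in_mult) auto
          moreover have "p dvd a' * b"
          proof -
            have "a' * b = lp * (a * b) - p * (la * ?v * b)"
              by (simp add: a'_def algebra_simps)
            then show ?thesis using less.prems(3) by (metis dvd_diff dvd_mult dvd_triv_left)
          qed
          ultimately consider "p dvd a'" | "p dvd b"
            using less.hyps \<open>deg_in u a' < deg_in u a\<close> less.prems(2) by blast
          then show ?thesis
          proof cases
            case 1
            have "lp * a = a' + p * (la * ?v)"
              by (simp add: a'_def algebra_simps)
            with 1 have "p dvd lp * a" by simp
            \<comment> \<open>Returning from the remainder to \<open>a\<close> costs the factor
              \<open>lp\<close>. It has degree 0 in \<open>u\<close>, so \<open>small\<close>
              applies to it; and \<open>p\<close>, of positive degree in \<open>u\<close>, cannot
              divide it.\<close>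
            then have "p dvd lp \<or> p dvd a"
              using small[of lp a] lp False less.prems by auto
            moreover have "\<not> p dvd lp"
            proof
              assume "p dvd lp"
              then obtain r where "lp = p * r" by (rule dvdE)
              moreover from this have "r \<noteq> 0" using lp(2) by auto
              ultimately show False using lp(3) False \<open>p \<noteq> 0\<close> by (simp add: deg_in_mult)
            qed
            ultimately show ?thesis by blast
          qed simp
        qed
      qed
      then show ?thesis by (auto simp: prime_in_def)
    qed
  qed
qed

text \<open>A given product \<open>a * b\<close> and divisor \<open>p\<close> contain finitely many
  variables, so the finite case settles the ring in infinitely many variables.\<close>

lemma irreducible_imp_prime_elem_dpoly:
  fixes p :: "('d, 'y, 'k::field) dpoly"
  assumes "irreducible p"
  shows "prime_elem p"
proof (rule prime_elemI)
  fix a b assume "p dvd a * b"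
  moreover have "prime_in (vars p \<union> vars a \<union> vars b) p"
    using assms by (intro prime_in_of_irreducible) (auto simp: polys_in_def)
  ultimately show "p dvd a \<or> p dvd b" by (auto simp: prime_in_def polys_in_def)
qed (use assms in \<open>auto simp: irreducible_def\<close>)

text \<open>An irreducible factor \<open>r\<close> of \<open>a\<close> lies in the polynomials in
  \<open>V\<close> and would be a unit if it divided \<open>q\<close>. Being prime, it divides
  \<open>b\<close> and cancels on both sides; when \<open>a\<close> has become a unit, its inverse
  gives the cofactor.\<close>

lemma multiple_of_primitive:
  fixes a b p q :: "('d, 'y, 'k::field) dpoly"
  assumes "a * p = b * q" "a \<noteq> 0" "a \<in> polys_in V" "b \<in> polys_in V"
    and "\<And>r. r \<in> polys_in V \<Longrightarrow> r dvd q \<Longrightarrow> r \<in> range Const"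
  shows "\<exists>r\<in>polys_in V. p = r * q"
  using assms(1-4)
proof (induction "sum_degs a" arbitrary: a b rule: less_induct)
  case less
  show ?case
  proof (cases "a dvd 1")
    case True
    then obtain s where s: "s * a = 1" unfolding dvd_def by (metis mult.commute)
    then have "s dvd 1" by (metis dvd_triv_left)
    then have "s \<in> polys_in V" by (simp add: dpoly_unit_iff polys_in_def)
    moreover have "p = s * b * q"
    proof -
      have "p = s * (a * p)" using s by (simp flip: mult.assoc)
      then show ?thesis using less.prems(1) by (simp add: mult.assoc)
    qed
    ultimately show ?thesis using polys_in_mult less.prems by blast
  next
    case False
    obtain r a' where r: "irreducible r" "a = r * a'" "a' \<noteq> 0" "sum_degs a' < sum_degs a"
      using dpoly_irreducible_factor[OF less.prems(2) False] .
    have "r \<in> polys_in V" "a' \<in> polys_in V"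
      using polys_in_dvd[OF _ less.prems(2,3)] r(2) by auto
    then have "\<not> r dvd q"
      using assms(5)[of r] r(1) by (auto simp: irreducible_def dpoly_unit_iff)
    moreover have "r dvd b * q"
      using r(2) by (simp flip: less.prems(1) add: mult.assoc)
    ultimately have "r dvd b"
      using irreducible_imp_prime_elem_dpoly[OF r(1)] by (auto simp: prime_elem_def)
    then obtain b' where b': "b = r * b'" by (rule dvdE)
    have "r * (a' * p) = r * (b' * q)" using less.prems(1) r(2) b' by (simp add: mult.assoc)
    then have eq: "a' * p = b' * q" by (rule dpoly_mult_cancel) (use r in auto)
    show ?thesis
    \<comment> \<open>The zero case is separate because a divisor of 0 need not be a polynomial in
      \<open>V\<close>.\<close>
    proof (cases "b = 0")
      case True
      then have "p = 0" using less.prems by (simp add: dpoly_no_zero_divisors)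
      then show ?thesis by (intro bexI[of _ 0]) (auto simp: polys_in_def)
    next
      case False
      then have "b' \<in> polys_in V"
        using polys_in_dvd[of b' b] less.prems b' by auto
      with less.hyps[of a' b'] eq r \<open>a' \<in> polys_in V\<close> show ?thesis by blast
    qed
  qed
qed

section \<open>Reduction with respect to a characteristic set\<close>

lemma rankingD:
  assumes "ranking le"
  shows ranking_linear: "le u v \<or> le v u"
    and ranking_antisym: "le u v \<Longrightarrow> le v u \<Longrightarrow> u = v"
    and ranking_trans: "le u v \<Longrightarrow> le v w \<Longrightarrow> le u w"
    and ranking_apply_dop: "le u (apply_dop \<theta> u)"
proof -
  interpret linorder le "strict le"
    using assms by (simp add: ranking_def)
  show "le u v \<or> le v u" by (rule linear)
  show "le u v \<Longrightarrow> le v u \<Longrightarrow> u = v" by (rule order.antisym)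
  show "le u v \<Longrightarrow> le v w \<Longrightarrow> le u w" by (rule order.trans)
  show "le u (apply_dop \<theta> u)" using assms unfolding ranking_def by blast
qed

lemma apply_dop_0 [simp]: "apply_dop 0 u = u"
  by (simp add: apply_dop_def)

lemma apply_dop_neq: "\<theta> \<noteq> 0 \<Longrightarrow> apply_dop \<theta> u \<noteq> u"
  by (auto simp: apply_dop_def prod_eq_iff)

lemma leader:
  assumes "ranking le" "f \<notin> range Const"
  shows leader_in_vars: "leader le f \<in> vars f"
    and le_leader: "v \<in> vars f \<Longrightarrow> le v (leader le f)"
proof -
  have ex: "\<exists>u\<in>U. \<forall>v\<in>U. le v u" if "finite U" "U \<noteq> {}" for U
    using that
  proof (induction rule: finite_ne_induct)
    case (singleton u)
    then show ?case using ranking_linear[OF assms(1)] by blast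
  next
    case (insert u U)
    then obtain w where w: "w \<in> U" "\<forall>v\<in>U. le v w" by blast
    show ?case
    proof (cases "le u w")
      case True
      then show ?thesis using w by blast
    next
      case False
      then have "le w u" "le u u" using ranking_linear[OF assms(1)] by blast+
      then show ?thesis using w ranking_trans[OF assms(1)] by blast
    qed
  qed
  have "vars f \<noteq> {}" using assms(2) by (simp add: vars_empty_iff)
  then obtain u where u: "u \<in> vars f" "\<forall>v\<in>vars f. le v u"
    using ex[OF finite_vars] by blast
  then have "leader le f = u"
    unfolding leader_def using ranking_antisym[OF assms(1)] by (intro the_equality) blast+
  then show "leader le f \<in> vars f" "v \<in> vars f \<Longrightarrow> le v (leader le f)"
    using u by auto
qed

lemma deg_in_leader_pos:
  assumes "ranking le" "f \<notin> range Const"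
  shows "deg_in (leader le f) f > 0"
  using leader_in_vars[OF assms] deg_in_eq_0_iff[of "leader le f" f] by simp

lemma initial_neq_0:
  assumes "f \<notin> range Const"
  shows "initial le f \<noteq> 0"
proof -
  have "f \<noteq> 0" using assms by (metis Const_eq_0_iff rangeI)
  then show ?thesis unfolding initial_def by (rule coeff_in_deg_in_neq_0)
qed

lemma rank_less_linear:
  assumes "ranking le"
  shows "rank_less le r s \<or> r = s \<or> rank_less le s r"
  using ranking_linear[OF assms, of "fst r" "fst s"] by (auto simp: rank_less_def prod_eq_iff)

lemma rank_less_irrefl: "\<not> rank_less le r r"
  by (simp add: rank_less_def)

lemma apply_dop_leader_notin_vars:
  assumes "ranking le" "f \<notin> range Const" "le (leader le f) (leader le g)" "\<theta> \<noteq> 0"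
  shows "apply_dop \<theta> (leader le g) \<notin> vars f"
proof
  assume "apply_dop \<theta> (leader le g) \<in> vars f"
  then have "le (apply_dop \<theta> (leader le g)) (leader le g)"
    using le_leader[OF assms(1,2)] ranking_trans[OF assms(1)] assms(3) by blast
  then show False
    using ranking_antisym[OF assms(1)] ranking_apply_dop[OF assms(1)] apply_dop_neq[OF assms(4)] by blast
qed

text \<open>A proper derivative of the leader of \<open>g\<close> ranks above every variable of
  \<open>f\<close>. In a list of increasing rank, only later elements need then be tested against
  earlier ones.\<close>

lemma reduced_if_rank_less:
  assumes "ranking le" "f \<notin> range Const" "g \<notin> range Const" "rank_less le (rank le f) (rank le g)"
  shows "reduced le f g"
  unfolding reduced_def
proof (intro conjI allI impI)
  have le: "le (leader le f) (leader le g)"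
    using assms(4) ranking_linear[OF assms(1), of "leader le g" "leader le g"]
    by (auto simp: rank_less_def rank_def)
  show "apply_dop \<theta> (leader le g) \<notin> vars f" if "\<theta> \<noteq> 0" for \<theta>
    using apply_dop_leader_notin_vars[OF assms(1,2) le that] .
  show "deg_in (leader le g) f < deg_in (leader le g) g"
  proof (cases "leader le f = leader le g")
    case True
    then show ?thesis using assms(4) by (simp add: rank_less_def rank_def)
  next
    case False
    then have "leader le g \<notin> vars f"
      using le le_leader[OF assms(1,2)] ranking_antisym[OF assms(1)] by blast
    then have "deg_in (leader le g) f = 0" by (simp add: deg_in_eq_0_iff)
    then show ?thesis using deg_in_leader_pos[OF assms(1,3)] by simp
  qed
qed

section \<open>Minimality of rank\<close>

lemma characteristic_setD:
  assumes "characteristic_set le I As"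
  shows "autoreduced le (set As)"
    and "sorted_wrt (\<lambda>f g. rank_less le (rank le f) (rank le g)) As"
    and "set As \<subseteq> I"
    and "f \<in> set As \<Longrightarrow> f \<notin> range Const"
  using assms by (auto simp: characteristic_set_def autoreduced_list_def autoreduced_def)

text \<open>A nonconstant \<open>f\<close> could be spliced into \<open>As\<close> to lower its
  rank. Constants escape this argument, since no autoreduced set may contain them.\<close>

lemma reduced_wrt_characteristic_set:
  fixes f :: "('d, 'y, 'k::zero) dpoly"
  assumes le: "ranking le" and As: "characteristic_set le I As"
    and f: "f \<in> I" and red: "\<And>g. g \<in> set As \<Longrightarrow> reduced le f g"
  shows "f \<in> range Const"
proof (rule ccontr)
  assume nonconst: "f \<notin> range Const"
  define P where "P g \<longleftrightarrow> rank_less le (rank le g) (rank le f)" for g :: "('d, 'y, 'k) dpoly"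
  define n where "n = length (takeWhile P As)"
  have tw: "takeWhile P As = take n As"
    unfolding n_def by (rule takeWhile_eq_take)
  have n: "n \<le> length As" unfolding n_def by (rule length_takeWhile_le)
  have P: "P g" "g \<in> set As" if "g \<in> set (take n As)" for g
    using that set_takeWhileD[of g P As] by (auto simp: tw)
  \<comment> \<open>The elements of rank below that of \<open>f\<close>, followed by \<open>f\<close>, would form an autoreduced set of lower rank.\<close>
  let ?Bs = "take n As @ [f]"
  have "autoreduced le (set ?Bs)"
    unfolding autoreduced_def
  proof (intro conjI ballI impI)
    show "set ?Bs \<inter> range Const = {}"
      using nonconst P(2) characteristic_setD(4)[OF As] by auto
  next
    fix g h assume gh: "g \<in> set ?Bs" "h \<in> set ?Bs" "g \<noteq> h"
    consider "g = f" "h \<in> set As" | "h = f" "P g" "g \<in> set As" | "g \<in> set As" "h \<in> set As"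
      using gh P by auto
    then show "reduced le g h"
    proof cases
      case 2
      then show ?thesis
        using reduced_if_rank_less[OF le _ nonconst] characteristic_setD(4)[OF As] by (simp add: P_def)
    qed (use red characteristic_setD(1)[OF As] gh(3) in \<open>auto simp: autoreduced_def\<close>)
  qed
  moreover have "sorted_wrt (\<lambda>f g. rank_less le (rank le f) (rank le g)) ?Bs"
    using characteristic_setD(2)[OF As] P(1) by (auto simp: sorted_wrt_append sorted_wrt_take P_def)
  moreover have "set ?Bs \<subseteq> I"
    using f P(2) characteristic_setD(3)[OF As] by auto
  moreover have "lower_rank le ?Bs As"
  \<comment> \<open>Either \<open>f\<close> undercuts the first element of \<open>As\<close> whose
    rank is not below its own (equal ranks contradict reducedness), or it is appended to all of
    \<open>As\<close>, and the longer list counts as lower.\<close>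
  proof (cases "n < length As")
    case True
    have "\<not> P (As ! n)"
      using True unfolding n_def by (rule nth_length_takeWhile)
    moreover have "rank le f \<noteq> rank le (As ! n)"
      using red[of "As ! n"] True by (auto simp: reduced_def rank_def)
    ultimately have "rank_less le (rank le f) (rank le (As ! n))"
      using rank_less_linear[OF le] by (metis P_def)
    then show ?thesis
      unfolding lower_rank_def using True
      by (intro disjI1 exI[of _ n]) (auto simp: nth_append)
  next
    case False
    then show ?thesis
      unfolding lower_rank_def using n by (intro disjI2) (auto simp: nth_append)
  qed
  ultimately show False
    using As unfolding characteristic_set_def autoreduced_list_def by blast
qed

text \<open>The first difference in rank, or failing that a difference in length, would make one of
  the two lists lower than the other.\<close>

lemma characteristic_sets_same_ranks:
  assumes le: "ranking le" and As: "characteristic_set le I As" and Bs: "characteristic_set le I Bs"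
  shows "length As = length Bs \<and> (\<forall>i<length As. rank le (As ! i) = rank le (Bs ! i))"
proof -
  have not_lower: "\<not> lower_rank le As Bs" "\<not> lower_rank le Bs As"
    using As Bs by (auto simp: characteristic_set_def)
  have eq: "rank le (As ! i) = rank le (Bs ! i)" if "i < length As" "i < length Bs" for i
    using that
  proof (induction i rule: less_induct)
    case (less i)
    then have below: "\<forall>j<i. rank le (As ! j) = rank le (Bs ! j)" by simp
    have "\<not> rank_less le (rank le (As ! i)) (rank le (Bs ! i))"
      using not_lower(1) less.prems below unfolding lower_rank_def by blast
    moreover have "\<not> rank_less le (rank le (Bs ! i)) (rank le (As ! i))"
      using not_lower(2) less.prems below unfolding lower_rank_def by fastforce
    ultimately show ?case using rank_less_linear[OF le] by blast
  qed
  moreover have "length As = length Bs"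
  proof (rule ccontr)
    assume "length As \<noteq> length Bs"
    then consider "length Bs < length As" | "length As < length Bs" by linarith
    then have "lower_rank le As Bs \<or> lower_rank le Bs As"
    proof cases
      case 1
      with eq show ?thesis by (auto simp: lower_rank_def)
    next
      case 2
      with eq show ?thesis by (auto simp: lower_rank_def)
    qed
    with not_lower show False by blast
  qed
  ultimately show ?thesis by simp
qed

lemma leaders_eq:
  assumes le: "ranking le" and As: "characteristic_set le I As"
  shows "leaders le I = leader le ` set As"
proof -
  have "leader le ` set Bs = leader le ` set As" if Bs: "characteristic_set le I Bs" for Bs
  proof -
    have "map (leader le) Bs = map (leader le) As"
    proof (rule nth_equalityI)
      show "length (map (leader le) Bs) = length (map (leader le) As)"
        using characteristic_sets_same_ranks[OF le As Bs] by simp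
    next
      fix i assume "i < length (map (leader le) Bs)"
      then show "map (leader le) Bs ! i = map (leader le) As ! i"
        using characteristic_sets_same_ranks[OF le As Bs] by (simp add: rank_def)
    qed
    from arg_cong[where f = set, OF this] show ?thesis by simp
  qed
  then show ?thesis using As unfolding leaders_def by blast
qed

text \<open>For distinct elements this is part of reducedness; for \<open>f = g\<close>, which
  \<open>autoreduced\<close> leaves open, it follows from the ranking.\<close>

lemma proper_derivative_of_leader_notin_vars:
  assumes "ranking le" "autoreduced le A" "f \<in> A" "g \<in> A" "\<theta> \<noteq> 0"
  shows "apply_dop \<theta> (leader le g) \<notin> vars f"
proof (cases "f = g")
  case True
  have "f \<notin> range Const" using assms(2,3) by (auto simp: autoreduced_def)
  moreover have "le (leader le f) (leader le g)"
    using ranking_linear[OF assms(1), of "leader le f" "leader le f"] True by simp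
  ultimately show ?thesis
    using apply_dop_leader_notin_vars[OF assms(1)] assms(5) by blast
next
  case False
  then show ?thesis using assms by (auto simp: autoreduced_def reduced_def)
qed

text \<open>The initials are free of leaders, so they multiply the coefficients in a leader like
  scalars and leave degrees alone; nor do they bring in variables that are not already in the two
  polynomials. Equal ranks make reducedness with respect to \<open>Bs ! j\<close> and to
  \<open>Cs ! j\<close> impose the same bounds.\<close>

lemma initial_combination_reduced:
  fixes Bs Cs :: "('d, 'y, 'k::comm_ring_1) dpoly list"
  assumes le: "ranking le" and Cs: "characteristic_set le I Cs" and Bs: "characteristic_set le I Bs"
    and inC: "\<And>f. f \<in> set Cs \<Longrightarrow> initial le f \<in> polys_in (nonleaders le I)"
    and inB: "\<And>f. f \<in> set Bs \<Longrightarrow> initial le f \<in> polys_in (nonleaders le I)"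
    and i: "i < length Cs" and g: "g \<in> set Cs"
  shows "reduced le (initial le (Cs ! i) * Bs ! i - initial le (Bs ! i) * Cs ! i) g"
proof -
  let ?b = "Bs ! i" and ?c = "Cs ! i" and ?u = "leader le g"
  let ?D = "initial le ?c * ?b - initial le ?b * ?c"
  obtain j where j: "j < length Cs" "g = Cs ! j" using g by (metis in_set_conv_nth)
  have same: "length Bs = length Cs" "\<And>l. l < length Cs \<Longrightarrow> rank le (Bs ! l) = rank le (Cs ! l)"
    using characteristic_sets_same_ranks[OF le Cs Bs] by auto
  have mem: "?b \<in> set Bs" "?c \<in> set Cs" "Bs ! j \<in> set Bs" using i j same by auto
  have leader: "leader le (Bs ! j) = ?u" "deg_in ?u (Bs ! j) = deg_in ?u g"
    using same(2)[OF j(1)] j(2) by (auto simp: rank_def)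
  have vars: "vars ?D \<subseteq> vars ?b \<union> vars ?c"
    using vars_diff[of "initial le ?c * ?b" "initial le ?b * ?c"]
      vars_mult_subset[of "initial le ?c" ?b] vars_mult_subset[of "initial le ?b" ?c]
      vars_coeff_in[of _ _ ?c] vars_coeff_in[of _ _ ?b]
    unfolding initial_def by blast
  have "?u \<in> leaders le I" using g leaders_eq[OF le Cs] by simp
  then have "?u \<notin> nonleaders le I"
    unfolding nonleaders_def using apply_dop_0[of ?u, symmetric] by blast
  then have u: "?u \<notin> vars (initial le ?c)" "?u \<notin> vars (initial le ?b)"
    using inC[OF mem(2)] inB[OF mem(1)] by (auto simp: polys_in_def)
  \<comment> \<open>In both alternatives the cross-multiplied coefficients cancel. The second arises
    only for \<open>g = Cs ! i\<close>, in the exact degree of \<open>g\<close>.\<close>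
  have deg: "coeff_in ?u n ?b = 0 \<and> coeff_in ?u n ?c = 0 \<or>
      coeff_in ?u n ?b = initial le ?b \<and> coeff_in ?u n ?c = initial le ?c" if n: "n \<ge> deg_in ?u g" for n
  proof (cases "j = i")
    case True
    then show ?thesis
      using n leader j coeff_in_eq_0[of ?u ?b n] coeff_in_eq_0[of ?u ?c n]
      by (cases "n = deg_in ?u g") (auto simp: initial_def)
  next
    case False
    have ne: "Xs ! i \<noteq> Xs ! j" if "characteristic_set le I Xs" "length Xs = length Cs" for Xs
      using characteristic_setD(2)[OF that(1)] that(2) i j(1) False
      by (metis linorder_neqE_nat rank_less_irrefl sorted_wrt_nth_less)
    have "deg_in ?u ?b < n" "deg_in ?u ?c < n"
    proof -
      have "reduced le ?b (Bs ! j)"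
        using ne[OF Bs same(1)] characteristic_setD(1)[OF Bs] mem unfolding autoreduced_def by blast
      then show "deg_in ?u ?b < n" using n leader by (simp add: reduced_def)
      have "reduced le ?c g"
        using ne[OF Cs refl] characteristic_setD(1)[OF Cs] mem g j unfolding autoreduced_def by blast
      then show "deg_in ?u ?c < n" using n by (simp add: reduced_def)
    qed
    then show ?thesis by (simp add: coeff_in_eq_0)
  qed
  show ?thesis
    unfolding reduced_def
  proof (intro conjI allI impI)
    fix \<theta> :: "'d dop" assume \<theta>: "\<theta> \<noteq> 0"
    show "apply_dop \<theta> ?u \<notin> vars ?D"
      using proper_derivative_of_leader_notin_vars[OF le characteristic_setD(1)[OF Cs] mem(2) g \<theta>]
        proper_derivative_of_leader_notin_vars[OF le characteristic_setD(1)[OF Bs] mem(1,3) \<theta>]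
        vars leader(1) by auto
  next
    show "deg_in ?u ?D < deg_in ?u g"
    proof (rule deg_in_less)
      fix n assume n: "n \<ge> deg_in ?u g"
      have "coeff_in ?u n ?D = initial le ?c * coeff_in ?u n ?b - initial le ?b * coeff_in ?u n ?c"
        by (simp add: coeff_in_diff coeff_in_mult_notin_vars u)
      also have "\<dots> = 0"
        using deg[OF n] by (elim disjE conjE) (simp_all add: mult.commute)
      finally show "coeff_in ?u n ?D = 0" .
    qed (use deg_in_leader_pos[OF le] characteristic_setD(4)[OF Cs g] in blast)
  qed
qed

section \<open>Evaluation at a point of the differential field\<close>

definition eval_monom :: "(('d, 'y) dvar \<Rightarrow> 'k::comm_semiring_1) \<Rightarrow> ('d, 'y) dmonom \<Rightarrow> 'k" where
  "eval_monom v m = (\<Prod>u\<in>Poly_Mapping.keys m. v u ^ Poly_Mapping.lookup m u)"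

definition eval_dpoly :: "(('d, 'y) dvar \<Rightarrow> 'k::comm_semiring_1) \<Rightarrow> ('d, 'y, 'k) dpoly \<Rightarrow> 'k" where
  "eval_dpoly v p = (\<Sum>m\<in>Poly_Mapping.keys p. Poly_Mapping.lookup p m * eval_monom v m)"

lemma eval_monom_superset:
  assumes "finite U" "Poly_Mapping.keys m \<subseteq> U"
  shows "eval_monom v m = (\<Prod>u\<in>U. v u ^ Poly_Mapping.lookup m u)"
  unfolding eval_monom_def
  by (rule prod.mono_neutral_left) (use assms in \<open>auto simp: in_keys_iff\<close>)

lemma eval_monom_add: "eval_monom v (s + t) = eval_monom v s * eval_monom v t"
proof -
  let ?U = "Poly_Mapping.keys s \<union> Poly_Mapping.keys t"
  have "eval_monom v (s + t) = (\<Prod>u\<in>?U. v u ^ Poly_Mapping.lookup (s + t) u)"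
    by (rule eval_monom_superset) (simp_all add: keys_add)
  also have "\<dots> = eval_monom v s * eval_monom v t"
    by (simp add: lookup_add power_add prod.distrib eval_monom_superset[of ?U])
  finally show ?thesis .
qed

lemma eval_monom_single: "eval_monom v (Poly_Mapping.single u n) = v u ^ n"
  by (cases "n = 0") (simp_all add: eval_monom_def)

lemma eval_dpoly_superset:
  assumes "finite M" "Poly_Mapping.keys p \<subseteq> M"
  shows "eval_dpoly v p = (\<Sum>m\<in>M. Poly_Mapping.lookup p m * eval_monom v m)"
  unfolding eval_dpoly_def
  by (rule sum.mono_neutral_left) (use assms in \<open>auto simp: in_keys_iff\<close>)

lemma eval_dpoly_0 [simp]: "eval_dpoly v 0 = 0"
  by (simp add: eval_dpoly_def)

lemma eval_dpoly_single: "eval_dpoly v (Poly_Mapping.single m c) = c * eval_monom v m"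
  by (cases "c = 0") (simp_all add: eval_dpoly_def)

lemma eval_dpoly_add: "eval_dpoly v (p + q) = eval_dpoly v p + eval_dpoly v q"
proof -
  let ?M = "Poly_Mapping.keys p \<union> Poly_Mapping.keys q"
  have "eval_dpoly v (p + q) = (\<Sum>m\<in>?M. Poly_Mapping.lookup (p + q) m * eval_monom v m)"
    by (rule eval_dpoly_superset) (simp_all add: keys_add)
  also have "\<dots> = eval_dpoly v p + eval_dpoly v q"
    by (simp add: lookup_add distrib_right sum.distrib eval_dpoly_superset[of ?M])
  finally show ?thesis .
qed

lemma eval_dpoly_sum: "eval_dpoly v (\<Sum>i\<in>A. f i) = (\<Sum>i\<in>A. eval_dpoly v (f i))"
  by (induction A rule: infinite_finite_induct) (simp_all add: eval_dpoly_add)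

lemma eval_dpoly_mult: "eval_dpoly v (p * q) = eval_dpoly v p * eval_dpoly v q"
proof (induction p rule: poly_mapping_single_induct)
  case (single s c)
  show ?case
  proof (induction q rule: poly_mapping_single_induct)
    case (single t d)
    then show ?case by (simp add: mult_single eval_dpoly_single eval_monom_add ac_simps)
  qed (simp_all add: distrib_left eval_dpoly_add)
qed (simp_all add: distrib_right eval_dpoly_add)

lemma eval_dpoly_Const [simp]: "eval_dpoly v (Const c) = c"
  by (simp add: Const_def eval_dpoly_single) (simp add: eval_monom_def)

lemma eval_dpoly_1 [simp]: "eval_dpoly v 1 = 1"
  using eval_dpoly_Const[of v 1] by (simp add: Const_1)

lemma eval_dpoly_Var [simp]: "eval_dpoly v (Var u) = v u"
  by (simp add: Var_def eval_dpoly_single eval_monom_single)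

lemma eval_dpoly_power: "eval_dpoly v (p ^ n) = eval_dpoly v p ^ n"
  by (induction n) (simp_all add: eval_dpoly_mult)

section \<open>Derivations of the coefficient field and evaluation\<close>

lemma differential_fieldD:
  assumes "differential_field \<delta>"
  shows "\<delta> i (a + b) = \<delta> i a + \<delta> i b"
    and "\<delta> i (a * b) = \<delta> i a * b + a * \<delta> i b"
    and "\<delta> i (\<delta> j a) = \<delta> j (\<delta> i a)"
    and "\<delta> i 0 = 0"
    and "\<delta> i 1 = 0"
proof -
  show add: "\<delta> i (a + b) = \<delta> i a + \<delta> i b" for a b using assms by (simp add: differential_field_def)
  show mult: "\<delta> i (a * b) = \<delta> i a * b + a * \<delta> i b" for a b using assms by (simp add: differential_field_def)
  show "\<delta> i (\<delta> j a) = \<delta> j (\<delta> i a)"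
    using assms unfolding differential_field_def by blast
  show "\<delta> i 0 = 0" using add[of 0 0] by (metis add.right_neutral add_left_cancel)
  show "\<delta> i 1 = 0" using mult[of 1 1]
    by (metis add.right_neutral add_left_cancel mult_1 mult.right_neutral)
qed

lemma derivation_power:
  assumes "differential_field \<delta>"
  shows "\<delta> i (a ^ n) = of_nat n * a ^ (n - 1) * \<delta> i a"
proof (induction n)
  case (Suc n)
  have "\<delta> i (a ^ Suc n) = \<delta> i a * a ^ n + a * (of_nat n * a ^ (n - 1) * \<delta> i a)"
    using Suc by (simp add: differential_fieldD(2)[OF assms])
  also have "a * (of_nat n * a ^ (n - 1) * \<delta> i a) = of_nat n * a ^ n * \<delta> i a"
    by (cases n) (simp_all add: ac_simps)
  finally show ?case by (simp add: algebra_simps)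
qed (simp add: differential_fieldD(5)[OF assms])

lemma derivation_sum:
  assumes "differential_field \<delta>"
  shows "\<delta> i (\<Sum>x\<in>A. f x) = (\<Sum>x\<in>A. \<delta> i (f x))"
  by (induction A rule: infinite_finite_induct)
    (simp_all add: differential_fieldD(1,4)[OF assms])

text \<open>The product rule for a power product. If \<open>u\<close> does not occur in
  \<open>m\<close>, truncated subtraction spoils the exponent, but the factor
  \<open>of_nat (lookup m u)\<close> is then 0. Summing over a superset \<open>U\<close> lets all
  monomials of a polynomial share one index set.\<close>

lemma derivation_eval_monom:
  assumes \<delta>: "differential_field \<delta>" and "finite U" "Poly_Mapping.keys m \<subseteq> U"
  shows "\<delta> i (eval_monom v m) =
    (\<Sum>u\<in>U. of_nat (Poly_Mapping.lookup m u) * eval_monom v (m - Poly_Mapping.single u 1) * \<delta> i (v u))"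
  using assms(3)
proof (induction m rule: poly_mapping_single_induct)
  case zero
  have "eval_monom v 0 = 1" by (simp add: eval_monom_def)
  then show ?case by (simp add: differential_fieldD(5)[OF \<delta>])
next
  case (single w n)
  show ?case
  proof (cases "n = 0")
    case True
    have "eval_monom v 0 = 1" by (simp add: eval_monom_def)
    with True show ?thesis by (simp add: differential_fieldD(5)[OF \<delta>])
  next
    case False
    then have "w \<in> U" using single by simp
    have "(\<Sum>u\<in>U. of_nat (Poly_Mapping.lookup (Poly_Mapping.single w n) u) *
        eval_monom v (Poly_Mapping.single w n - Poly_Mapping.single u 1) * \<delta> i (v u)) =
      (\<Sum>u\<in>U. if u = w then of_nat n * v w ^ (n - 1) * \<delta> i (v w) else 0)"
      by (intro sum.cong refl)
        (auto simp: lookup_single when_def eval_monom_single simp flip: single_diff)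
    also have "\<dots> = \<delta> i (eval_monom v (Poly_Mapping.single w n))"
      using \<open>w \<in> U\<close> \<open>finite U\<close> by (simp add: eval_monom_single derivation_power[OF \<delta>])
    finally show ?thesis ..
  qed
next
  case (add s t)
  let ?e = "\<lambda>u. Poly_Mapping.single u (1::nat)"
  have keys: "Poly_Mapping.keys s \<subseteq> U" "Poly_Mapping.keys t \<subseteq> U"
    using add.prems by (auto simp: in_keys_iff lookup_add subset_iff)
  \<comment> \<open>The factor guards the identity: moving \<open>t\<close> out of the truncated
    subtraction can fail when \<open>u\<close> does not occur in \<open>s\<close>.\<close>
  have left: "of_nat (Poly_Mapping.lookup s u) * eval_monom v (s + t - ?e u) =
      of_nat (Poly_Mapping.lookup s u) * (eval_monom v (s - ?e u) * eval_monom v t)" for s t u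
  proof (cases "Poly_Mapping.lookup s u = 0")
    case False
    then have "s + t - ?e u = (s - ?e u) + t"
      by (intro poly_mapping_eqI) (auto simp: lookup_add lookup_minus lookup_single when_def)
    then show ?thesis by (simp add: eval_monom_add)
  qed simp
  have right: "of_nat (Poly_Mapping.lookup t u) * eval_monom v (s + t - ?e u) =
      of_nat (Poly_Mapping.lookup t u) * (eval_monom v (t - ?e u) * eval_monom v s)" for u
    using left[of t u s] by (simp add: add.commute)
  have "(\<Sum>u\<in>U. of_nat (Poly_Mapping.lookup (s + t) u) * eval_monom v (s + t - ?e u) * \<delta> i (v u)) =
      (\<Sum>u\<in>U. of_nat (Poly_Mapping.lookup s u) * eval_monom v (s - ?e u) * \<delta> i (v u)) * eval_monom v t +
      eval_monom v s * (\<Sum>u\<in>U. of_nat (Poly_Mapping.lookup t u) * eval_monom v (t - ?e u) * \<delta> i (v u))"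
    unfolding sum_distrib_left sum_distrib_right sum.distrib[symmetric]
  proof (rule sum.cong[OF refl])
    fix u
    have "of_nat (Poly_Mapping.lookup (s + t) u) * eval_monom v (s + t - ?e u) * \<delta> i (v u) =
        of_nat (Poly_Mapping.lookup s u) * eval_monom v (s + t - ?e u) * \<delta> i (v u) +
        of_nat (Poly_Mapping.lookup t u) * eval_monom v (s + t - ?e u) * \<delta> i (v u)"
      by (simp add: lookup_add distrib_right)
    then show "of_nat (Poly_Mapping.lookup (s + t) u) * eval_monom v (s + t - ?e u) * \<delta> i (v u) =
        of_nat (Poly_Mapping.lookup s u) * eval_monom v (s - ?e u) * \<delta> i (v u) * eval_monom v t +
        eval_monom v s * (of_nat (Poly_Mapping.lookup t u) * eval_monom v (t - ?e u) * \<delta> i (v u))"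
      unfolding left right by (simp only: ac_simps)
  qed
  also have "\<dots> = \<delta> i (eval_monom v s) * eval_monom v t + eval_monom v s * \<delta> i (eval_monom v t)"
    using add.IH keys by simp
  also have "\<dots> = \<delta> i (eval_monom v (s + t))"
    by (simp add: eval_monom_add differential_fieldD(2)[OF \<delta>])
  finally show ?case ..
qed

text \<open>The product rule splits the derivative of each evaluated term into a part from the
  coefficient and a part from the variables; these are the values of the two summands of
  \<open>dderiv\<close>.\<close>

lemma eval_dpoly_dderiv:
  assumes \<delta>: "differential_field \<delta>"
    and v: "\<And>u. v (apply_dop (Poly_Mapping.single i 1) u) = \<delta> i (v u)"
  shows "eval_dpoly v (dderiv \<delta> i p) = \<delta> i (eval_dpoly v p)"
proof -
  let ?K = "Poly_Mapping.keys p"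
  let ?t = "\<lambda>m u. of_nat (Poly_Mapping.lookup m u) * eval_monom v (m - Poly_Mapping.single u 1) * \<delta> i (v u)"
  \<comment> \<open>\<open>Poly_Mapping.map\<close> keeps absent coefficients at 0, in agreement
    with \<open>\<delta> i 0 = 0\<close>.\<close>
  have lookup_map: "Poly_Mapping.lookup (Poly_Mapping.map (\<delta> i) p) m = \<delta> i (Poly_Mapping.lookup p m)" for m
    by (simp add: map.rep_eq when_def differential_fieldD(4)[OF \<delta>])
  have "eval_dpoly v (Poly_Mapping.map (\<delta> i) p) = (\<Sum>m\<in>?K. \<delta> i (Poly_Mapping.lookup p m) * eval_monom v m)"
  proof -
    have "Poly_Mapping.keys (Poly_Mapping.map (\<delta> i) p) \<subseteq> ?K"
      by (auto simp: in_keys_iff lookup_map differential_fieldD(4)[OF \<delta>])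
    then show ?thesis by (simp add: eval_dpoly_superset[of ?K] lookup_map)
  qed
  moreover have "eval_dpoly v (\<Sum>u\<in>vars p. pderiv_in u p * Var (apply_dop (Poly_Mapping.single i 1) u)) =
      (\<Sum>m\<in>?K. Poly_Mapping.lookup p m * (\<Sum>u\<in>vars p. ?t m u))"
  proof -
    have "eval_dpoly v (\<Sum>u\<in>vars p. pderiv_in u p * Var (apply_dop (Poly_Mapping.single i 1) u)) =
        (\<Sum>u\<in>vars p. \<Sum>m\<in>?K. Poly_Mapping.lookup p m * ?t m u)"
      by (simp add: eval_dpoly_sum eval_dpoly_mult v[unfolded One_nat_def] pderiv_in_def eval_dpoly_single sum_distrib_right)
        (simp add: ac_simps)
    then show ?thesis
      by (simp add: sum_distrib_left sum.swap[of _ "vars p"])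
  qed
  moreover have "\<delta> i (eval_monom v m) = (\<Sum>u\<in>vars p. ?t m u)" if "m \<in> ?K" for m
    using that by (intro derivation_eval_monom[OF \<delta>]) (auto simp: vars_def)
  ultimately have "eval_dpoly v (dderiv \<delta> i p) =
      (\<Sum>m\<in>?K. \<delta> i (Poly_Mapping.lookup p m) * eval_monom v m + Poly_Mapping.lookup p m * \<delta> i (eval_monom v m))"
    by (simp add: dderiv_def eval_dpoly_add sum.distrib)
  then show ?thesis
    by (simp add: eval_dpoly_def derivation_sum[OF \<delta>] differential_fieldD(2)[OF \<delta>])
qed

lemma funpow_derivation_commute:
  assumes "differential_field \<delta>"
  shows "(\<delta> j ^^ n) (\<delta> i x) = \<delta> i ((\<delta> j ^^ n) x)"
proof (induction n)
  case (Suc n)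
  then show ?case using differential_fieldD(3)[OF assms, of j i] by simp
qed simp

text \<open>The action composes iterates of the derivations along an arbitrary enumeration of the
  finite index type. Commutativity brings one additional derivation to the front.\<close>

lemma derivative_operator_action:
  fixes \<delta> :: "'d::finite \<Rightarrow> 'k::field \<Rightarrow> 'k"
  assumes \<delta>: "differential_field \<delta>"
  shows "\<exists>D :: 'd dop \<Rightarrow> 'k \<Rightarrow> 'k.
    \<forall>x. D 0 x = x \<and> (\<forall>i \<theta>. D (Poly_Mapping.single i 1 + \<theta>) x = \<delta> i (D \<theta> x))"
proof -
  define E where "E ds \<theta> x = foldr (\<lambda>i. \<delta> i ^^ Poly_Mapping.lookup \<theta> i) ds x" for ds \<theta> x
  \<comment> \<open>For the induction, partial enumerations are allowed: an index outside
    \<open>ds\<close> is not seen at all, and one inside is counted once by distinctness.\<close>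
  have "E ds (Poly_Mapping.single i 1 + \<theta>) x = (if i \<in> set ds then \<delta> i (E ds \<theta> x) else E ds \<theta> x)"
    if "distinct ds" for ds i \<theta> x
    using that
    by (induction ds)
      (auto simp: E_def lookup_add lookup_single when_def funpow_derivation_commute[OF \<delta>])
  moreover have "E ds 0 x = x" for ds x
    by (induction ds) (simp_all add: E_def)
  moreover obtain ds :: "'d list" where "set ds = UNIV" "distinct ds"
    using finite_distinct_list[of "UNIV :: 'd set"] by auto
  ultimately show ?thesis by (intro exI[of _ "E ds"]) simp
qed

lemma dpoly_affine_expansion:
  fixes f :: "('d, 'y, 'k::comm_semiring_1) dpoly"
  assumes "vars f = {u}" "deg_in u f = 1"
  obtains a b where "f = Const b + Const a * Var u" "coeff_in u 1 f = Const a"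
proof -
  have "\<exists>c. coeff_in u i f = Const c" for i
    using vars_coeff_in[of u i f] vars_empty_iff[of "coeff_in u i f"] assms(1) by auto
  then obtain c where c: "\<And>i. coeff_in u i f = Const (c i)" by metis
  have "f = (\<Sum>i\<le>1. coeff_in u i f * Var u ^ i)"
    by (rule coeff_in_expansion) (simp add: assms(2))
  then have "f = Const (c 0) + Const (c 1) * Var u" by (simp add: c)
  with c that show ?thesis by blast
qed

lemma pderiv_in_affine:
  "pderiv_in u (Const b + Const a * Var u) = (Const a :: ('d, 'y, 'k::comm_semiring_1) dpoly)"
proof -
  let ?f = "Const b + Const a * Var u :: ('d, 'y, 'k) dpoly" and ?e = "Poly_Mapping.single u (1::nat)"
  have f: "?f = Poly_Mapping.single 0 b + Poly_Mapping.single ?e a"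
    by (simp add: Const_def Var_def mult_single)
  have e: "?e \<noteq> 0"
  proof
    assume "?e = 0"
    then have "Poly_Mapping.lookup ?e u = 0" by (simp only: lookup_zero)
    then show False by simp
  qed
  have "Poly_Mapping.keys ?f \<subseteq> {0, ?e}"
    unfolding f using keys_add[of "Poly_Mapping.single 0 b" "Poly_Mapping.single ?e a"]
    by (auto split: if_splits)
  then have "pderiv_in u ?f = (\<Sum>m\<in>{0, ?e}. Poly_Mapping.single (m - Poly_Mapping.single u 1)
      (of_nat (Poly_Mapping.lookup m u) * Poly_Mapping.lookup ?f m))"
    unfolding pderiv_in_def by (intro sum.mono_neutral_left) (auto simp: in_keys_iff)
  then show ?thesis using e unfolding f by (simp add: lookup_add lookup_single when_def Const_def)
qed

section \<open>The unit ideal is not characterizable\<close>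

lemma eval_dpoly_prod_list: "eval_dpoly v (prod_list ps) = prod_list (map (eval_dpoly v) ps)"
  by (induction ps) (simp_all add: eval_dpoly_mult)

lemma differential_ideal_eval_kernel:
  assumes \<delta>: "differential_field \<delta>"
    and v: "\<And>i u. v (apply_dop (Poly_Mapping.single i 1) u) = \<delta> i (v u)"
  shows "differential_ideal \<delta> {p. eval_dpoly v p = 0}"
  by (simp add: differential_ideal_def eval_dpoly_add eval_dpoly_mult differential_fieldD(4)[OF \<delta>]
      eval_dpoly_dderiv[of \<delta> v, OF \<delta> v])

lemma Var_not_const: "(Var u :: ('d, 'y, 'k::comm_semiring_1) dpoly) \<notin> range Const"
  using vars_empty_iff[of "Var u :: ('d, 'y, 'k) dpoly"] by simp

lemma deg_in_Var: "deg_in w (Var u :: ('d, 'y, 'k::comm_semiring_1) dpoly) = (if w = u then 1 else 0)"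
  by (simp add: Var_def deg_in_def lookup_single when_def)

text \<open>Each y_j is itself in the ideal and so fails to be reduced with respect to some element,
  which must then have rank y_j to the power 1. Autoreducedness bars y_j and its derivatives from
  all other elements, and every variable is such a derivative.\<close>

lemma characteristic_set_of_UNIV:
  fixes As :: "('d, 'y, 'k::comm_semiring_1) dpoly list"
  assumes le: "ranking le" and As: "characteristic_set le UNIV As"
  shows "\<exists>g. set As = range g \<and> (\<forall>j. vars (g j) = {(0, j)} \<and> deg_in (0, j) (g j) = 1)"
proof -
  note nonconst = characteristic_setD(4)[OF As] and autored = characteristic_setD(1)[OF As]
  have "\<exists>g\<in>set As. leader le g = (0, j) \<and> deg_in (0, j) g = 1" for j
  proof -
    let ?x = "Var (0, j) :: ('d, 'y, 'k) dpoly"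
    obtain g where g: "g \<in> set As" "\<not> reduced le ?x g"
      using reduced_wrt_characteristic_set[OF le As, of ?x] Var_not_const by blast
    have "apply_dop \<theta> (leader le g) \<notin> vars ?x" if "\<theta> \<noteq> 0" for \<theta>
    proof
      assume "apply_dop \<theta> (leader le g) \<in> vars ?x"
      \<comment> \<open>Exponents are natural numbers, so a sum of operators is trivial only if both
        are.\<close>
      then have "\<theta> + fst (leader le g) = 0" by (simp add: apply_dop_def)
      then have "Poly_Mapping.lookup (\<theta> + fst (leader le g)) i = 0" for i by simp
      then have "Poly_Mapping.lookup \<theta> i = 0" for i by (simp add: lookup_add)
      then have "\<theta> = 0" by (intro poly_mapping_eqI) simp
      with that show False ..
    qed
    then have "deg_in (leader le g) g \<le> deg_in (leader le g) ?x"
      using g(2) by (auto simp: reduced_def)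
    moreover have "deg_in (leader le g) g > 0"
      using deg_in_leader_pos[OF le nonconst] g(1) by blast
    ultimately have "leader le g = (0, j) \<and> deg_in (0, j) g = 1"
      by (auto simp: deg_in_Var split: if_splits)
    with g(1) show ?thesis by blast
  qed
  then obtain g where g: "\<And>j. g j \<in> set As" "\<And>j. leader le (g j) = (0, j)" "\<And>j. deg_in (0, j) (g j) = 1"
    by metis
  \<comment> \<open>The variable \<open>(\<theta>, j)\<close> is \<open>\<theta>\<close> applied to
    the leader of \<open>g j\<close>, so its occurrence is governed by that leader alone.\<close>
  have only: "f = g j \<and> \<theta> = 0" if f: "f \<in> set As" "(\<theta>, j) \<in> vars f" for f \<theta> j
  proof -
    have "\<theta> = 0"
    proof (rule ccontr)
      assume "\<theta> \<noteq> 0"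
      from proper_derivative_of_leader_notin_vars[OF le autored f(1) g(1)[of j] this] f(2)
      show False by (simp add: g(2) apply_dop_def)
    qed
    moreover have "f = g j"
    proof (rule ccontr)
      assume "f \<noteq> g j"
      then have "reduced le f (g j)" using autored f(1) g(1)[of j] unfolding autoreduced_def by simp
      then have "deg_in (0, j) f = 0" by (simp add: reduced_def g)
      then show False using f(2) \<open>\<theta> = 0\<close> deg_in_eq_0_iff[of "(0, j)" f] by simp
    qed
    ultimately show ?thesis by blast
  qed
  have mem: "(0, j) \<in> vars (g j)" for j
    using leader_in_vars[OF le nonconst[OF g(1)[of j]]] g(2)[of j] by simp
  have inj: "j = l" if "g j = g l" for j l
  proof -
    have "leader le (g j) = leader le (g l)" using that by (rule arg_cong)
    then show ?thesis unfolding g(2) by simp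
  qed
  have vars: "vars (g j) = {(0, j)}" for j
  proof
    show "vars (g j) \<subseteq> {(0, j)}"
    proof
      fix u assume "u \<in> vars (g j)"
      moreover obtain \<theta> l where u: "u = (\<theta>, l)" by (cases u)
      ultimately have "(\<theta>, l) \<in> vars (g j)" by simp
      note eq = only[OF g(1)[of j] this]
      show "u \<in> {(0, j)}" using inj[OF conjunct1[OF eq]] conjunct2[OF eq] u by simp
    qed
  qed (use mem in simp)
  have "f \<in> range g" if "f \<in> set As" for f
  proof -
    obtain \<theta> j where "leader le f = (\<theta>, j)" by (cases "leader le f")
    then have "f = g j"
      using only[OF that, of \<theta> j] leader_in_vars[OF le nonconst[OF that]] by simp
    then show ?thesis by (rule range_eqI)
  qed
  then have "set As = range g" using g(1) by auto
  then show ?thesis using vars g(3) by (intro exI[of _ g]) simp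
qed

lemma one_notin_characterizable:
  fixes I :: "('d::finite, 'y, 'k::field) dpoly set"
  assumes \<delta>: "differential_field \<delta>" and le: "ranking le" and I: "characterizable \<delta> le I"
  shows "1 \<notin> I"
proof
  assume "1 \<in> I"
  have ideal: "differential_ideal \<delta> I" using I by (simp add: characterizable_def)
  have "p * 1 \<in> I" for p
    using ideal \<open>1 \<in> I\<close> unfolding differential_ideal_def by blast
  then have "I = UNIV" by auto
  then obtain As where As: "characteristic_set le UNIV As"
    and sat: "UNIV = saturation (differential_ideal_gen \<delta> (set As)) (H_prod le As)"
    using I by (auto simp: characterizable_def)
  obtain g where "set As = range g \<and> (\<forall>j. vars (g j) = {(0, j)} \<and> deg_in (0, j) (g j) = 1)"
    using characteristic_set_of_UNIV[OF le As] by (rule exE)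
  then have range: "set As = range g"
    and g: "\<And>j. vars (g j) = {(0, j)}" "\<And>j. deg_in (0, j) (g j) = 1"
    by (rule conjunct1, blast+)
  have "\<exists>a b. g j = Const b + Const a * Var (0, j) \<and> coeff_in (0, j) 1 (g j) = Const a" for j
    using dpoly_affine_expansion[OF g] by metis
  then obtain a b where ab: "\<And>j. g j = Const (b j) + Const (a j) * Var (0, j)"
    "\<And>j. coeff_in (0, j) 1 (g j) = Const (a j)" by metis
  have nonconst: "g j \<notin> range Const" for j
    using g(1)[of j] by (simp flip: vars_empty_iff)
  have leader: "leader le (g j) = (0, j)" for j
    using leader_in_vars[OF le nonconst[of j]] g(1)[of j] by simp
  have initial: "initial le (g j) = Const (a j)" for j
    by (simp add: initial_def leader g(2) ab(2)[simplified])
  have a: "a j \<noteq> 0" for j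
    using initial_neq_0[OF nonconst[of j], of le] by (simp add: initial)
  have separant: "separant le (g j) = Const (a j)" for j
    unfolding separant_def leader by (subst ab(1)) (rule pderiv_in_affine)
  obtain D :: "'d dop \<Rightarrow> 'k \<Rightarrow> 'k"
    where "\<forall>x. D 0 x = x \<and> (\<forall>i \<theta>. D (Poly_Mapping.single i 1 + \<theta>) x = \<delta> i (D \<theta> x))"
    using derivative_operator_action[OF \<delta>] by (rule exE)
  then have D: "D 0 x = x" "D (Poly_Mapping.single i 1 + \<theta>) x = \<delta> i (D \<theta> x)" for i \<theta> x
    by blast+
  \<comment> \<open>The value of y_j is the root of the affine polynomial \<open>g j\<close>; the
    values at its derivatives are the ones that make evaluation commute with the
    derivations.\<close>
  define v where "v u = D (fst u) (- b (snd u) / a (snd u))" for u :: "('d, 'y) dvar"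
  let ?J = "{p. eval_dpoly v p = 0}"
  have "v (apply_dop (Poly_Mapping.single i 1) u) = \<delta> i (v u)" for i u
    unfolding v_def apply_dop_def fst_conv snd_conv by (rule D(2))
  then have "differential_ideal \<delta> ?J"
    by (rule differential_ideal_eval_kernel[OF \<delta>])
  moreover have "eval_dpoly v (g j) = 0" for j
    using a[of j] by (simp add: ab(1) eval_dpoly_add eval_dpoly_mult v_def D(1))
  then have "set As \<subseteq> ?J" unfolding range by blast
  ultimately have "differential_ideal_gen \<delta> (set As) \<subseteq> ?J"
    unfolding differential_ideal_gen_def by blast
  \<comment> \<open>Membership of 1 in the saturation says that a power of
    \<open>H_prod le As\<close> lies in the differential ideal, hence evaluates to 0. But each
    initial and separant evaluates to some nonzero \<open>a j\<close>.\<close>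
  moreover obtain m where "H_prod le As ^ m * 1 \<in> differential_ideal_gen \<delta> (set As)"
    using sat unfolding saturation_def by blast
  ultimately have "eval_dpoly v (H_prod le As) ^ m = 0"
    by (auto simp: eval_dpoly_power)
  then have "eval_dpoly v (H_prod le As) = 0" by simp
  then have "\<exists>f\<in>set As. eval_dpoly v (initial le f) * eval_dpoly v (separant le f) = 0"
    by (auto simp: H_prod_def eval_dpoly_prod_list prod_list_zero_iff eval_dpoly_mult)
  then show False using a unfolding range by (auto simp: initial separant)
qed

section \<open>Comparison of characteristic sets\<close>

theorem corollary1:
  fixes \<delta> :: "'d::finite \<Rightarrow> 'k::field_char_0 \<Rightarrow> 'k"
    and le :: "('d, 'y::finite) dvar \<Rightarrow> ('d, 'y) dvar \<Rightarrow> bool"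
    and I :: "('d, 'y, 'k) dpoly set"
    and Cs Bs :: "('d, 'y, 'k) dpoly list"
  assumes "differential_field \<delta>"
    and "ranking le"
    and "characterizable \<delta> le I"
    and "canonical_characteristic_set le I Cs"
    and "characteristic_set le I Bs"
    and "\<forall>f\<in>set Bs. initial le f \<in> polys_in (nonleaders le I)"
  shows "length Bs = length Cs \<and>
    (\<forall>i<length Cs. \<exists>q\<in>polys_in (nonleaders le I). Bs ! i = q * Cs ! i)"
proof (intro conjI allI impI)
  note le = assms(2) and Bs = assms(5)
  have Cs: "characteristic_set le I Cs"
    and canonical: "\<And>f. f \<in> set Cs \<Longrightarrow> initial le f \<in> polys_in (nonleaders le I)"
      "\<And>f q. f \<in> set Cs \<Longrightarrow> q \<in> polys_in (nonleaders le I) \<Longrightarrow> q dvd f \<Longrightarrow> q \<in> range Const"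
    using assms(4) by (auto simp: canonical_characteristic_set_def)
  show len: "length Bs = length Cs"
    using characteristic_sets_same_ranks[OF le Bs Cs] by simp
  fix i assume i: "i < length Cs"
  let ?b = "Bs ! i" and ?c = "Cs ! i"
  have mem: "?b \<in> set Bs" "?c \<in> set Cs" using i len by auto
  have ideal: "differential_ideal \<delta> I" using assms(3) by (simp add: characterizable_def)
  have bI: "?b \<in> I" and cI: "?c \<in> I"
    using mem characteristic_setD(3)[OF Bs] characteristic_setD(3)[OF Cs] by auto
  let ?D = "initial le ?c * ?b - initial le ?b * ?c"
  have "initial le ?c * ?b + (- initial le ?b) * ?c \<in> I"
    using ideal bI cI unfolding differential_ideal_def by blast
  then have "?D \<in> I" by simp
  moreover have "reduced le ?D g" if "g \<in> set Cs" for g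
    using initial_combination_reduced[OF le Cs Bs canonical(1) _ i that] assms(6) by blast
  ultimately have "?D \<in> range Const"
    using reduced_wrt_characteristic_set[OF le Cs] by blast
  then obtain k where k: "?D = Const k" by blast
  have "?D = 0"
  proof (rule ccontr)
    assume "?D \<noteq> 0"
    \<comment> \<open>A nonzero constant is a unit, so it would put 1 into the ideal.\<close>
    then have "Const (inverse k) * ?D = 1"
      by (simp add: k Const_1 flip: Const_mult)
    moreover have "Const (inverse k) * ?D \<in> I"
      using ideal \<open>?D \<in> I\<close> unfolding differential_ideal_def by blast
    ultimately show False
      using one_notin_characterizable[OF assms(1-3)] by simp
  qed
  then have "initial le ?c * ?b = initial le ?b * ?c" by simp
  then show "\<exists>q\<in>polys_in (nonleaders le I). ?b = q * ?c"
  proof (rule multiple_of_primitive)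
    show "initial le ?c \<noteq> 0"
      using initial_neq_0 characteristic_setD(4)[OF Cs mem(2)] by blast
    show "r \<in> range Const" if "r \<in> polys_in (nonleaders le I)" "r dvd ?c" for r
      using canonical(2)[OF mem(2) that] .
  qed (use canonical(1) mem assms(6) in auto)
qed

end
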